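(* Let $N\ge2$, $s\in(1/2,1)$, and let $V\colon(0,+\infty)\to[0,+\infty)$ and $K\colon(0,+\infty)\to(0,+\infty)$ be continuous. Assume there exists $R_1>0$ such that \[ \sup_{r\in(0,R_1)}\frac{K(r)}{r^{\alpha_0}V(r)^{\beta_0}}<+\infty \] for some $0\le\beta_0\le1$ and $\alpha_0>\alpha^*_s(\beta_0)$. Then $\lim_{R\to0^+}\mathcal S_0(q_1,R)=0$ for every $q_1\in\mathbb{R}$ such that $\max\{1,2\beta_0\}<q_1<q^*(\alpha_0,\beta_0,s)$.
   Context: $\alpha^*_s(\beta)=-\frac N2-(1-2\beta)s$ for $0\le\beta\le\frac12$ and $\alpha^*_s(\beta)=-(1-\beta)N$ for $\frac12\le\beta\le1$; $q^*(\alpha,\beta,s)=2\frac{\alpha-2s\beta+N}{N-2s}$. $B_R$ is the open ball of radius $R$ centered at $0$. For $0<s<1$, $2^*_s=\frac{2N}{N-2s}$, $C(N,s)=\left(\int_{\mathbb{R}^N}\frac{1-\cos\zeta_1}{|\zeta|^{N+2s}}d\zeta\right)^{-1}$, $[u]_{H^s}=\left(\frac{C(N,s)}{2}\iint\frac{|u(x)-u(y)|^2}{|x-y|^{N+2s}}dx\,dy\right)^{1/2}$, $\dot H^s(\mathbb{R}^N)=\{u\in L^{2^*_s}:[u]_{H^s}<\infty\}$, $H^s_V(\mathbb{R}^N)=\{u\in\dot H^s:\int V(|x|)|u|^2<\infty\}$ with norm $\|u\|^2=[u]_{H^s}^2+\int V(|x|)|u|^2dx$, $H^s_{V,\mathrm{rad}}$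 its radial subspace. $\mathcal S_0(q,R)=\sup\{\int_{B_R}K(|x|)|u|^qdx:u\in H^s_{V,\mathrm{rad}},\|u\|=1\}$. The convention $V^0=1$ is used. *)

theory Defs
  imports "HOL-Analysis.Analysis"
begin

definition alpha_star :: "nat \<Rightarrow> real \<Rightarrow> real \<Rightarrow> real" where
  "alpha_star N s \<beta> =
     (if \<beta> \<le> 1/2 then - real N / 2 - (1 - 2 * \<beta>) * s else - (1 - \<beta>) * real N)"

definition q_star :: "nat \<Rightarrow> real \<Rightarrow> real \<Rightarrow> real \<Rightarrow> real" where
  "q_star N \<alpha> \<beta> s = 2 * (\<alpha> - 2 * s * \<beta> + real N) / (real N - 2 * s)"

definition crit_exp :: "nat \<Rightarrow> real \<Rightarrow> real" where
  "crit_exp N s = 2 * real N / (real N - 2 * s)"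

text \<open>Power with the convention V^0 = 1 (Isabelle has 0 powr 0 = 0).\<close>
definition vpow :: "real \<Rightarrow> real \<Rightarrow> real" where
  "vpow v b = (if b = 0 then 1 else v powr b)"

text \<open>The constant C(N,s); the first coordinate is taken along a fixed basis vector.\<close>
definition CNs :: "'a::euclidean_space itself \<Rightarrow> real \<Rightarrow> real" where
  "CNs _ s = inverse (enn2real (\<integral>\<^sup>+ \<zeta>. ennreal ((1 - cos (\<zeta> \<bullet> (SOME b::'a. b \<in> Basis)))
                 / norm \<zeta> powr (real DIM('a) + 2 * s)) \<partial>lborel))"

definition gagliardo_sq :: "real \<Rightarrow> ('a::euclidean_space \<Rightarrow> real) \<Rightarrow> ennreal" where
  "gagliardo_sq s u = ennreal (CNs TYPE('a) s / 2) *
     (\<integral>\<^sup>+ x. \<integral>\<^sup>+ y. ennreal ((u x - u y)^2 / norm (x - y) powr (real DIM('a) + 2 * s)) \<partial>lborel \<partial>lborel)"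

definition V_part :: "(real \<Rightarrow> real) \<Rightarrow> ('a::euclidean_space \<Rightarrow> real) \<Rightarrow> ennreal" where
  "V_part V u = (\<integral>\<^sup>+ x. ennreal (V (norm x) * (u x)^2) \<partial>lborel)"

definition Hdot :: "real \<Rightarrow> ('a::euclidean_space \<Rightarrow> real) set" where
  "Hdot s = {u. u \<in> borel_measurable lborel
              \<and> (\<integral>\<^sup>+ x. ennreal (\<bar>u x\<bar> powr crit_exp DIM('a) s) \<partial>lborel) < \<infinity>
              \<and> gagliardo_sq s u < \<infinity>}"

definition HV :: "real \<Rightarrow> (real \<Rightarrow> real) \<Rightarrow> ('a::euclidean_space \<Rightarrow> real) set" where
  "HV s V = {u \<in> Hdot s. V_part V u < \<infinity>}"

definition radial :: "('a::real_normed_vector \<Rightarrow> real) \<Rightarrow> bool" where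
  "radial u \<longleftrightarrow> (\<forall>x y. norm x = norm y \<longrightarrow> u x = u y)"

definition HV_rad :: "real \<Rightarrow> (real \<Rightarrow> real) \<Rightarrow> ('a::euclidean_space \<Rightarrow> real) set" where
  "HV_rad s V = {u \<in> HV s V. radial u}"

text \<open>Squared norm \<open>\<parallel>u\<parallel>^2 = [u]^2 + \<integral> V|u|^2\<close> (for u in HV).\<close>
definition HV_norm_sq :: "real \<Rightarrow> (real \<Rightarrow> real) \<Rightarrow> ('a::euclidean_space \<Rightarrow> real) \<Rightarrow> real" where
  "HV_norm_sq s V u = enn2real (gagliardo_sq s u) + enn2real (V_part V u)"

definition S0 :: "'a::euclidean_space itself \<Rightarrow> real \<Rightarrow> (real \<Rightarrow> real) \<Rightarrow> (real \<Rightarrow> real)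
                  \<Rightarrow> real \<Rightarrow> real \<Rightarrow> ennreal" where
  "S0 _ s V K q R = (SUP u \<in> {u :: 'a \<Rightarrow> real. u \<in> HV_rad s V \<and> HV_norm_sq s V u = 1}.
       \<integral>\<^sup>+ x \<in> ball 0 R. ennreal (K (norm x) * \<bar>u x\<bar> powr q) \<partial>lborel)"

end

theory Submission
  imports Defs
begin

text \<open>
  Everything rests on the radial estimate \<open>\<bar>u x\<bar> \<le> M [u] \<bar>x\<bar> powr (s - N/2)\<close>, valid for
  almost every \<open>x\<close> because \<open>2 s > 1\<close>. It is obtained by telescoping the averages of \<open>u\<close> over
  the balls of radius \<open>2\<^sup>k \<bar>x\<bar>\<close>, \<open>k \<in> \<int>\<close>, centred at \<open>x\<close>. Two consecutive averages differ by an amount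
  controlled by the integral over the larger ball of
  \<open>g(y) = \<integral> \<bar>u(y) - u(z)\<bar>\<^sup>2 / \<bar>y - z\<bar>\<^bsup>N + 2 s\<^esup> dz\<close>. Large balls are
  handled by the total mass of \<open>g\<close>, and the averages vanish at infinity since \<open>u\<close> lies in some
  \<open>L\<^sup>p\<close>. For small balls one uses that \<open>g\<close> is itself radial, so a ball of radius \<open>d\<close> carries
  at most a fraction of order \<open>(d / \<bar>x\<bar>)\<^bsup>N - 1\<^esup>\<close> of the mass; the averages converge to \<open>u x\<close>
  wherever \<open>g x < \<infinity>\<close>, so no differentiation theorem is needed.

  With this bound inserted for the excess power \<open>\<bar>u\<bar> powr (q - 2 \<beta>)\<close>, Young's inequality
  gives \<open>K \<bar>u\<bar> powr q \<le> C (\<bar>x\<bar> powr \<eta> V u\<^sup>2 + \<bar>x\<bar> powr \<kappa>)\<close> near the origin with some \<open>\<eta> > 0\<close> and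
  \<open>\<kappa> > -N\<close>, which is exactly what \<open>q < q\<^sup>*(\<alpha>, \<beta>, s)\<close> provides.
\<close>

subsection \<open>Rotation invariance of Lebesgue measure and mass of balls under radial densities\<close>

lemma ball_in_sets_borel [measurable]: "ball x r \<in> sets borel" for x :: "'a::metric_space"
  by simp

lemma nn_integral_lborel_translate:
  fixes f :: "'a::euclidean_space \<Rightarrow> ennreal"
  assumes [measurable]: "f \<in> borel_measurable borel"
  shows "(\<integral>\<^sup>+ x. f (t + x) \<partial>lborel) = (\<integral>\<^sup>+ x. f x \<partial>lborel)"
proof -
  have "(\<integral>\<^sup>+ x. f x \<partial>lborel) = (\<integral>\<^sup>+ x. f x \<partial>(distr lborel borel ((+) t)))"
    by (subst lborel_distr_plus) simp
  also have "\<dots> = (\<integral>\<^sup>+ x. f (t + x) \<partial>lborel)"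
    by (subst nn_integral_distr) auto
  finally show ?thesis by simp
qed

lemma orthogonal_transformation_borel_measurable:
  fixes T :: "'a::euclidean_space \<Rightarrow> 'a"
  assumes "orthogonal_transformation T"
  shows "T \<in> borel_measurable borel"
  using assms
  by (intro borel_measurable_continuous_onI linear_continuous_on linear_conv_bounded_linear[THEN iffD1]
      orthogonal_transformation_linear)

lemma unit_ball_vol_neq_0 [simp]: "unit_ball_vol (real n) \<noteq> 0"
  by (rule less_imp_neq[THEN not_sym]) simp

text \<open>
  Uniqueness of translation-invariant measures, with the unit ball as normalising set:
  after translating by \<open>T x\<close> and by \<open>y\<close> in the double integral of \<open>f (T x)\<close> over
  \<open>y\<close> in the unit ball, only the volume of a ball is left of the \<open>x\<close>-integral.
\<close>
lemma nn_integral_lborel_orthogonal: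
  fixes f :: "'a::euclidean_space \<Rightarrow> ennreal" and T :: "'a \<Rightarrow> 'a"
  assumes f[measurable]: "f \<in> borel_measurable borel" and T: "orthogonal_transformation T"
  shows "(\<integral>\<^sup>+ x. f (T x) \<partial>lborel) = (\<integral>\<^sup>+ x. f x \<partial>lborel)"
proof -
  note [measurable] = orthogonal_transformation_borel_measurable[OF T]
    orthogonal_transformation_borel_measurable[OF orthogonal_transformation_inv[OF T]]
  have surj: "T (inv T y) = y" for y
    using orthogonal_transformation_surj[OF T] by (simp add: surj_f_inv_f)
  have lin: "linear T" using T by (rule orthogonal_transformation_linear)
  define v where "v = emeasure lborel (ball (0::'a) 1)"
  define I where "I = (indicator (ball (0::'a) 1) :: 'a \<Rightarrow> ennreal)"
  have [measurable]: "I \<in> borel_measurable borel"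
    unfolding I_def by (intro borel_measurable_indicator) simp
  have v: "v \<noteq> 0" "v \<noteq> \<infinity>" by (simp_all add: v_def emeasure_ball)
  have I_int: "(\<integral>\<^sup>+ y. I y \<partial>lborel) = v" by (simp add: I_def v_def)
  have I_T: "(\<integral>\<^sup>+ x. I (y - T x) \<partial>lborel) = v" for y
  proof -
    \<comment> \<open>As T is an isometry, the points x with \<open>y - T x\<close> in the unit ball
      form the unit ball about \<open>inv T y\<close>, whose volume does not depend on y.\<close>
    have "I (y - T x) = indicator (ball (inv T y) 1) x" for x
    proof -
      have "norm (y - T x) = norm (T (inv T y - x))"
        by (simp add: linear_diff[OF lin] surj)
      also have "\<dots> = norm (inv T y - x)" by (rule orthogonal_transformation_norm[OF T])
      finally show ?thesis by (simp add: I_def indicator_def dist_norm norm_minus_commute)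
    qed
    then show ?thesis by (simp add: v_def emeasure_ball)
  qed
  have "(\<integral>\<^sup>+ x. f (T x) \<partial>lborel) * v = (\<integral>\<^sup>+ x. (\<integral>\<^sup>+ y. f (T x) * I y \<partial>lborel) \<partial>lborel)"
    by (simp add: nn_integral_cmult I_int nn_integral_multc)
  also have "\<dots> = (\<integral>\<^sup>+ y. (\<integral>\<^sup>+ x. f (T x) * I y \<partial>lborel) \<partial>lborel)"
    by (rule lborel_pair.Fubini') measurable
  also have "\<dots> = (\<integral>\<^sup>+ y. (\<integral>\<^sup>+ x. f (T x + y) * I y \<partial>lborel) \<partial>lborel)"
  proof (rule nn_integral_cong)
    fix y :: 'a
    have "(\<integral>\<^sup>+ x. f (T x) * I y \<partial>lborel) = (\<integral>\<^sup>+ x. f (T (inv T y + x)) * I y \<partial>lborel)"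
      by (subst nn_integral_lborel_translate[symmetric, where t = "inv T y"]) measurable
    then show "(\<integral>\<^sup>+ x. f (T x) * I y \<partial>lborel) = (\<integral>\<^sup>+ x. f (T x + y) * I y \<partial>lborel)"
      by (simp add: linear_add[OF lin] surj add.commute)
  qed
  also have "\<dots> = (\<integral>\<^sup>+ x. (\<integral>\<^sup>+ y. f (T x + y) * I y \<partial>lborel) \<partial>lborel)"
    by (rule lborel_pair.Fubini') measurable
  also have "\<dots> = (\<integral>\<^sup>+ x. (\<integral>\<^sup>+ y. f y * I (y - T x) \<partial>lborel) \<partial>lborel)"
  proof (rule nn_integral_cong)
    fix x :: 'a
    show "(\<integral>\<^sup>+ y. f (T x + y) * I y \<partial>lborel) = (\<integral>\<^sup>+ y. f y * I (y - T x) \<partial>lborel)"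
      by (subst nn_integral_lborel_translate[symmetric, of _ "T x"]) simp_all
  qed
  also have "\<dots> = (\<integral>\<^sup>+ y. (\<integral>\<^sup>+ x. f y * I (y - T x) \<partial>lborel) \<partial>lborel)"
    by (rule lborel_pair.Fubini') measurable
  also have "\<dots> = (\<integral>\<^sup>+ y. f y \<partial>lborel) * v"
    by (simp add: nn_integral_cmult nn_integral_multc I_T)
  finally show ?thesis
    using v by (intro antisym) (simp_all add: ennreal_mult_le_mult_iff[of v, symmetric] mult.commute)
qed

text \<open>The witness is the reflection in the hyperplane orthogonal to \<open>a - b\<close>;
  equal norms put the midpoint of a and b on it.\<close>

lemma reflection_exists:
  fixes a b :: "'a::euclidean_space"
  assumes "norm a = norm b"
  obtains T where "orthogonal_transformation T" "T a = b"
proof (cases "a = b")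
  case True
  then show ?thesis using that[of "\<lambda>x. x"] by simp
next
  case False
  define w where "w = a - b"
  define T where "T x = x - (2 * (x \<bullet> w) / (w \<bullet> w)) *\<^sub>R w" for x
  have w: "w \<bullet> w \<noteq> 0" using False by (simp add: w_def)
  have "linear T"
    by (rule linearI) (simp_all add: T_def algebra_simps inner_simps add_divide_distrib)
  moreover have "T x \<bullet> T y = x \<bullet> y" for x y
    using w by (simp add: T_def inner_simps inner_commute field_simps)
  ultimately have "orthogonal_transformation T"
    by (simp add: orthogonal_transformation_def)
  moreover have "a \<bullet> a = b \<bullet> b"
    using assms by (simp add: norm_eq)
  \<comment> \<open>This makes the coefficient of w in \<open>T a\<close> equal to 1, so
    \<open>T a = a - w = b\<close>.\<close>
  then have "2 * (a \<bullet> w) = w \<bullet> w"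
    by (simp add: w_def inner_simps inner_commute)
  then have "T a = b"
    using w by (simp add: T_def w_def)
  ultimately show ?thesis by (rule that)
qed

section \<open>Mass that a rotation invariant density gives to off-centre balls\<close>

lemma radial_orthogonal:
  assumes "radial u" "orthogonal_transformation T"
  shows "u (T x) = u x"
  using assms orthogonal_transformation_norm unfolding radial_def by blast

text \<open>A reflection taking a to b preserves g and Lebesgue measure and carries one ball onto
  the other.\<close>

lemma nn_integral_ball_rotate:
  fixes g :: "'a::euclidean_space \<Rightarrow> ennreal"
  assumes [measurable]: "g \<in> borel_measurable borel"
    and g: "\<And>T x. orthogonal_transformation T \<Longrightarrow> g (T x) = g x"
    and "norm a = norm b"
  shows "(\<integral>\<^sup>+ x \<in> ball a d. g x \<partial>lborel) = (\<integral>\<^sup>+ x \<in> ball b d. g x \<partial>lborel)"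
proof -
  obtain T where T: "orthogonal_transformation T" "T a = b"
    using reflection_exists assms(3) by blast
  have "dist (T a) (T x) = dist a x" for x
    using orthogonal_transformation_norm[OF T(1), of "a - x"]
      linear_diff[OF orthogonal_transformation_linear[OF T(1)], of a x]
    by (simp add: dist_norm)
  then have "(\<integral>\<^sup>+ x \<in> ball a d. g x \<partial>lborel)
      = (\<integral>\<^sup>+ x. g (T x) * indicator (ball b d) (T x) \<partial>lborel)"
    using T by (intro nn_integral_cong) (auto simp: g indicator_def)
  also have "\<dots> = (\<integral>\<^sup>+ x \<in> ball b d. g x \<partial>lborel)"
    by (intro nn_integral_lborel_orthogonal[OF _ T(1)] borel_measurable_times_ennreal
        borel_measurable_indicator assms(1)) simp
  finally show ?thesis .
qed

text \<open>
  The integral of \<open>g\<close> over \<open>ball x (2 * d)\<close> is averaged over the points \<open>x\<close> of the shell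
  \<open>\<bar>x0\<bar> \<le> \<bar>x\<bar> < \<bar>x0\<bar> + d\<close>; each such ball contains a rotated copy of \<open>ball x0 d\<close>.
\<close>
lemma nn_integral_ball_radial_le:
  fixes g :: "'a::euclidean_space \<Rightarrow> ennreal"
  assumes [measurable]: "g \<in> borel_measurable borel"
    and g: "\<And>T x. orthogonal_transformation T \<Longrightarrow> g (T x) = g x"
    and d: "0 < d" and x0: "x0 \<noteq> 0"
  shows "(\<integral>\<^sup>+ x \<in> ball x0 d. g x \<partial>lborel) * ennreal (d * norm x0 ^ (DIM('a) - 1))
    \<le> ennreal ((2 * d) ^ DIM('a)) * (\<integral>\<^sup>+ x. g x \<partial>lborel)"
proof -
  define \<rho> where "\<rho> = norm x0"
  have \<rho>: "\<rho> > 0" using x0 by (simp add: \<rho>_def)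
  define \<omega> where "\<omega> = unit_ball_vol DIM('a)"
  have \<omega>: "\<omega> > 0" by (simp add: \<omega>_def)
  define S where "S = ball (0::'a) (\<rho> + d) - ball 0 \<rho>"
  have [measurable]: "S \<in> sets borel" by (simp add: S_def)
  define J where "J = (\<integral>\<^sup>+ x \<in> ball x0 d. g x \<partial>lborel)"
  \<comment> \<open>Volume of the shell from below, by
    \<open>(\<rho> + d) ^ N \<ge> (\<rho> + d) * \<rho> ^ (N - 1)\<close> with N the
    dimension.\<close>
  have "ennreal (\<omega> * (d * \<rho> ^ (DIM('a) - 1))) \<le> emeasure lborel S"
  proof -
    have "emeasure lborel S = emeasure lborel (ball (0::'a) (\<rho> + d)) - emeasure lborel (ball (0::'a) \<rho>)"
      unfolding S_def using \<rho> d by (intro emeasure_Diff) (auto simp: emeasure_ball)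
    also have "\<dots> = ennreal (\<omega> * (\<rho> + d) ^ DIM('a) - \<omega> * \<rho> ^ DIM('a))"
      using \<rho> d by (simp add: emeasure_ball \<omega>_def ennreal_minus)
    finally have *: "emeasure lborel S = ennreal (\<omega> * (\<rho> + d) ^ DIM('a) - \<omega> * \<rho> ^ DIM('a))" .
    obtain n where n: "DIM('a) = Suc n"
      using DIM_positive[where 'a='a] by (metis gr0_conv_Suc)
    have "(\<rho> + d) * \<rho> ^ n \<le> (\<rho> + d) * (\<rho> + d) ^ n"
      using \<rho> d by (intro mult_left_mono power_mono) auto
    then have "d * \<rho> ^ (DIM('a) - 1) \<le> (\<rho> + d) ^ DIM('a) - \<rho> ^ DIM('a)"
      by (simp add: n algebra_simps)
    then have "\<omega> * (d * \<rho> ^ (DIM('a) - 1)) \<le> \<omega> * (\<rho> + d) ^ DIM('a) - \<omega> * \<rho> ^ DIM('a)"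
      using \<omega> by (simp flip: right_diff_distrib)
    then show ?thesis unfolding * by (rule ennreal_leI)
  qed
  then have "J * ennreal (\<omega> * (d * \<rho> ^ (DIM('a) - 1))) \<le> J * emeasure lborel S"
    by (rule mult_left_mono) simp
  also have "\<dots> = (\<integral>\<^sup>+ x. J * indicator S x \<partial>lborel)"
    by (simp add: nn_integral_cmult)
  also have "\<dots> \<le> (\<integral>\<^sup>+ x. (\<integral>\<^sup>+ y. g y * indicator (ball x (2 * d)) y * indicator S x \<partial>lborel) \<partial>lborel)"
  proof (rule nn_integral_mono)
    fix x :: 'a
    show "J * indicator S x \<le> (\<integral>\<^sup>+ y. g y * indicator (ball x (2 * d)) y * indicator S x \<partial>lborel)"
    proof (cases "x \<in> S")
      case True
      then have x: "\<rho> \<le> norm x" "norm x < \<rho> + d" by (auto simp: S_def)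
      \<comment> \<open>The radial projection of x to the sphere through \<open>x0\<close>. It moves
        x by \<open>norm x - \<rho> < d\<close>, so \<open>ball x' d\<close> lies in
        \<open>ball x (2 * d)\<close>.\<close>
      define x' where "x' = (\<rho> / norm x) *\<^sub>R x"
      have "norm x > 0" using x \<rho> by linarith
      have x': "norm x' = norm x0" using x \<rho> \<open>norm x > 0\<close> by (simp add: x'_def \<rho>_def)
      have "x - x' = (1 - \<rho> / norm x) *\<^sub>R x" by (simp add: x'_def algebra_simps)
      then have "dist x x' = \<bar>1 - \<rho> / norm x\<bar> * norm x" by (simp add: dist_norm)
      also have "\<dots> = norm x - \<rho>" using x \<rho> \<open>norm x > 0\<close> by (simp add: abs_if field_simps)
      finally have "ball x' d \<subseteq> ball x (2 * d)"
        using x by (intro ball_subset_ball_iff[THEN iffD2]) (auto simp: dist_commute)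
      then have "(\<integral>\<^sup>+ y \<in> ball x' d. g y \<partial>lborel) \<le> (\<integral>\<^sup>+ y \<in> ball x (2 * d). g y \<partial>lborel)"
        by (intro nn_integral_mono) (auto simp: indicator_def)
      moreover have "J = (\<integral>\<^sup>+ y \<in> ball x' d. g y \<partial>lborel)"
        unfolding J_def by (rule nn_integral_ball_rotate) (simp_all add: g x')
      ultimately show ?thesis using True by simp
    qed simp
  qed
  also have "\<dots> = (\<integral>\<^sup>+ y. (\<integral>\<^sup>+ x. g y * indicator (ball x (2 * d)) y * indicator S x \<partial>lborel) \<partial>lborel)"
  proof (rule lborel_pair.Fubini'[symmetric])
    \<comment> \<open>The ball moves with x, so its indicator is first written as that of one fixed
      subset of the product space.\<close>
    have "(\<lambda>(x, y). g y * indicator {z. dist (fst z) (snd z) < 2 * d} (x, y) * indicator S x)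
        \<in> borel_measurable (lborel \<Otimes>\<^sub>M lborel)"
      by measurable
    then show "(\<lambda>(x, y). g y * indicator (ball x (2 * d)) y * indicator S x)
        \<in> borel_measurable (lborel \<Otimes>\<^sub>M lborel)"
      by (simp add: indicator_def)
  qed
  also have "\<dots> \<le> (\<integral>\<^sup>+ y. g y * ennreal (\<omega> * (2 * d) ^ DIM('a)) \<partial>lborel)"
  proof (rule nn_integral_mono)
    fix y :: 'a
    \<comment> \<open>For fixed y, the centres x whose ball contains y form
      \<open>ball y (2 * d)\<close>; the restriction to S is dropped.\<close>
    have "(\<integral>\<^sup>+ x. g y * indicator (ball x (2 * d)) y * indicator S x \<partial>lborel)
        \<le> (\<integral>\<^sup>+ x. g y * indicator (ball y (2 * d)) x \<partial>lborel)"
      by (intro nn_integral_mono) (auto simp: indicator_def dist_commute)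
    also have "\<dots> = g y * ennreal (\<omega> * (2 * d) ^ DIM('a))"
      using d by (subst nn_integral_cmult_indicator) (simp_all add: emeasure_ball \<omega>_def)
    finally show "(\<integral>\<^sup>+ x. g y * indicator (ball x (2 * d)) y * indicator S x \<partial>lborel)
      \<le> g y * ennreal (\<omega> * (2 * d) ^ DIM('a))" .
  qed
  also have "\<dots> = ennreal \<omega> * (ennreal ((2 * d) ^ DIM('a)) * (\<integral>\<^sup>+ y. g y \<partial>lborel))"
    using \<omega> d by (subst nn_integral_multc) (simp_all add: ennreal_mult mult_ac)
  finally have "ennreal \<omega> * (J * ennreal (d * \<rho> ^ (DIM('a) - 1)))
      \<le> ennreal \<omega> * (ennreal ((2 * d) ^ DIM('a)) * (\<integral>\<^sup>+ y. g y \<partial>lborel))"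
    using \<omega> d \<rho> by (simp add: ennreal_mult mult_ac)
  then show ?thesis
    using \<omega> by (simp add: J_def \<rho>_def ennreal_mult_le_mult_iff)
qed

subsection \<open>Ball averages and the Gagliardo density\<close>

text \<open>The inner integral of \<open>gagliardo_sq\<close>, without the factor
  \<open>CNs / 2\<close>.\<close>

definition gagliardo_density :: "real \<Rightarrow> ('a::euclidean_space \<Rightarrow> real) \<Rightarrow> 'a \<Rightarrow> ennreal" where
  "gagliardo_density s u x =
     (\<integral>\<^sup>+ y. ennreal ((u x - u y)\<^sup>2 / norm (x - y) powr (real DIM('a) + 2 * s)) \<partial>lborel)"

text \<open>The value is 0 when u is not integrable on the ball, hence the explicit integrability
  assumptions below.\<close>

definition ball_average :: "('a::euclidean_space \<Rightarrow> real) \<Rightarrow> 'a \<Rightarrow> real \<Rightarrow> real" where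
  "ball_average u x r = (LINT y:ball x r|lborel. u y) / measure lborel (ball x r)"

lemma gagliardo_density_measurable [measurable]:
  assumes [measurable]: "u \<in> borel_measurable borel"
  shows "gagliardo_density s u \<in> borel_measurable borel"
  unfolding gagliardo_density_def by measurable

text \<open>Substitute \<open>T y\<close> for y in the inner integral: u and the distance are both
  preserved. This admits the density to \<open>nn_integral_ball_radial_le\<close>.\<close>

lemma gagliardo_density_orthogonal:
  fixes u :: "'a::euclidean_space \<Rightarrow> real"
  assumes [measurable]: "u \<in> borel_measurable borel" and u: "radial u"
    and T: "orthogonal_transformation T"
  shows "gagliardo_density s u (T x) = gagliardo_density s u x"
proof -
  have "norm (T x - T y) = norm (x - y)" for y
    using orthogonal_transformation_norm[OF T, of "x - y"]
      linear_diff[OF orthogonal_transformation_linear[OF T], of x y] by simp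
  then show ?thesis
    unfolding gagliardo_density_def
    by (subst nn_integral_lborel_orthogonal[OF _ T, symmetric])
      (simp_all add: radial_orthogonal[OF u T])
qed

text \<open>Jensen's inequality for the square. The constant c stays free: it will be a value of u
  or another average of u.\<close>

lemma average_deviation_le:
  fixes u :: "'a \<Rightarrow> real"
  assumes B: "B \<in> sets M" "emeasure M B \<noteq> \<infinity>" "measure M B \<noteq> 0"
    and u: "u \<in> borel_measurable M" "set_integrable M B u"
  shows "ennreal (((LINT x:B|M. u x) / measure M B - c)\<^sup>2) * emeasure M B
    \<le> (\<integral>\<^sup>+ x \<in> B. ennreal ((u x - c)\<^sup>2) \<partial>M)"
proof (cases "(\<integral>\<^sup>+ x \<in> B. ennreal ((u x - c)\<^sup>2) \<partial>M) = \<infinity>")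
  case False
  note [measurable] = B(1) u(1)
  define m where "m = (LINT x:B|M. u x) / measure M B"
  define b where "b = measure M B"
  have b: "b > 0" "emeasure M B = ennreal b"
    using B by (auto simp: b_def emeasure_eq_ennreal_measure zero_less_measure_iff less_top top.not_eq_extremum)
  have eq: "(\<integral>\<^sup>+ x \<in> B. ennreal ((u x - c)\<^sup>2) \<partial>M) = (\<integral>\<^sup>+ x. ennreal (indicator B x * (u x - c)\<^sup>2) \<partial>M)"
    by (intro nn_integral_cong) (auto simp: indicator_def)
  have int: "integrable M (\<lambda>x. indicator B x * (u x - c)\<^sup>2)"
    using False by (intro integrableI_nonneg) (auto simp: eq less_top)
  have int1: "integrable M (indicator B :: 'a \<Rightarrow> real)"
    using B by (auto simp: less_top)
  have int2: "integrable M (\<lambda>x. indicator B x * u x)"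
    using u(2) by (simp add: set_integrable_def)
  have m: "(\<integral>x. indicator B x * u x \<partial>M) = m * b"
    using B by (simp add: m_def b_def set_lebesgue_integral_def)
  have m1: "(\<integral>x. indicator B x \<partial>M) = b"
    using B by (simp add: b_def)
  \<comment> \<open>Jensen's inequality in the form \<open>q\<^sup>2 \<ge> 2 p q - p\<^sup>2\<close> with \<open>p = m - c\<close>, \<open>q = u x - c\<close>.\<close>
  have "(m - c)\<^sup>2 * b = (\<integral>x. 2 * (m - c) * (indicator B x * u x) - ((m - c) * (m + c)) * indicator B x \<partial>M)"
  proof (subst Bochner_Integration.integral_diff)
    show "(m - c)\<^sup>2 * b = (\<integral>x. 2 * (m - c) * (indicator B x * u x) \<partial>M) - (\<integral>x. (m - c) * (m + c) * indicator B x \<partial>M)"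
      by (simp only: integral_mult_right_zero m m1) (simp add: power2_eq_square algebra_simps)
  qed (intro integrable_mult_right int1 int2)+
  also have "\<dots> \<le> (\<integral>x. indicator B x * (u x - c)\<^sup>2 \<partial>M)"
  proof (rule integral_mono)
    fix x assume "x \<in> space M"
    have "0 \<le> (u x - m)\<^sup>2" by simp
    then show "2 * (m - c) * (indicator B x * u x) - ((m - c) * (m + c)) * indicator B x
        \<le> indicator B x * (u x - c)\<^sup>2"
      by (auto simp: indicator_def power2_eq_square algebra_simps)
  qed (use int int1 int2 in auto)
  finally have "ennreal ((m - c)\<^sup>2 * b) \<le> ennreal (\<integral>x. indicator B x * (u x - c)\<^sup>2 \<partial>M)"
    by (rule ennreal_leI)
  also have "\<dots> = (\<integral>\<^sup>+ x \<in> B. ennreal ((u x - c)\<^sup>2) \<partial>M)"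
    using int by (simp add: eq nn_integral_eq_integral)
  finally show ?thesis
    using b by (simp add: m_def b_def ennreal_mult)
qed (simp add: top_greatest)

text \<open>At distance at most D the singular kernel is at least
  \<open>D powr (- (N + 2 * s))\<close>, N being the dimension.\<close>

lemma nn_integral_sq_diff_le:
  fixes u :: "'a::euclidean_space \<Rightarrow> real"
  assumes [measurable]: "u \<in> borel_measurable borel"
    and D: "\<And>x. x \<in> B \<Longrightarrow> dist x y \<le> D" and s: "s > 0"
  shows "(\<integral>\<^sup>+ x \<in> B. ennreal ((u x - u y)\<^sup>2) \<partial>lborel)
    \<le> ennreal (D powr (real DIM('a) + 2 * s)) * gagliardo_density s u y"
proof -
  define p where "p = real DIM('a) + 2 * s"
  have "(\<integral>\<^sup>+ x \<in> B. ennreal ((u x - u y)\<^sup>2) \<partial>lborel)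
    \<le> (\<integral>\<^sup>+ x. ennreal (D powr p) * ennreal ((u y - u x)\<^sup>2 / norm (y - x) powr p) \<partial>lborel)"
  proof (rule nn_integral_mono)
    fix x :: 'a
    show "ennreal ((u x - u y)\<^sup>2) * indicator B x
      \<le> ennreal (D powr p) * ennreal ((u y - u x)\<^sup>2 / norm (y - x) powr p)"
    \<comment> \<open>The point \<open>x = y\<close> is split off because the quotient is 0 there by
      convention; the left side vanishes as well.\<close>
    proof (cases "x \<in> B \<and> x \<noteq> y")
      case True
      then have d: "0 < norm (y - x)" "norm (y - x) \<le> D"
        using D[of x] by (auto simp: dist_norm norm_minus_commute)
      have p: "p > 0" using s by (simp add: p_def add_nonneg_pos)
      have "norm (y - x) powr p \<le> D powr p"
        using d p by (intro powr_mono2) auto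
      then have "(u y - u x)\<^sup>2 * norm (y - x) powr p \<le> (u y - u x)\<^sup>2 * D powr p"
        by (rule mult_left_mono) simp
      then have "(u x - u y)\<^sup>2 \<le> D powr p * ((u y - u x)\<^sup>2 / norm (y - x) powr p)"
        using d by (simp add: field_simps power2_commute)
      then show ?thesis
        using True by (simp flip: ennreal_mult add: ennreal_leI)
    qed auto
  qed
  also have "\<dots> = ennreal (D powr p) * gagliardo_density s u y"
    unfolding gagliardo_density_def p_def by (rule nn_integral_cmult) measurable
  finally show ?thesis by (simp add: p_def)
qed

section \<open>Comparison of averages over a ball and its double\<close>

lemma ball_average_deviation_le:
  fixes u :: "'a::euclidean_space \<Rightarrow> real"
  assumes [measurable]: "u \<in> borel_measurable borel"
    and "set_integrable lborel (ball x r) u" "0 < r"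
  shows "ennreal ((ball_average u x r - c)\<^sup>2) * ennreal (unit_ball_vol DIM('a) * r ^ DIM('a))
    \<le> (\<integral>\<^sup>+ y \<in> ball x r. ennreal ((u y - c)\<^sup>2) \<partial>lborel)"
proof -
  have "measure lborel (ball x r) = unit_ball_vol DIM('a) * r ^ DIM('a)"
    using assms(3) by (simp add: content_ball)
  then show ?thesis
    using average_deviation_le[of "ball x r" lborel u c] assms
    by (simp add: ball_average_def emeasure_ball)
qed

text \<open>Jensen twice: over the larger ball with c the average over the smaller one, then, for
  each y in the larger ball, over the smaller one with \<open>c = u y\<close>. The product of the
  two volumes is the factor on the left.\<close>

lemma ball_average_diff_le:
  fixes u :: "'a::euclidean_space \<Rightarrow> real"
  assumes [measurable]: "u \<in> borel_measurable borel"
    and int: "\<And>r. set_integrable lborel (ball x r) u" and r: "0 < r" and s: "s > 0"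
  shows "ennreal ((ball_average u x r - ball_average u x (2 * r))\<^sup>2)
      * ennreal ((unit_ball_vol DIM('a))\<^sup>2 * 2 ^ DIM('a) * r ^ (2 * DIM('a)))
    \<le> ennreal ((4 * r) powr (real DIM('a) + 2 * s))
      * (\<integral>\<^sup>+ y \<in> ball x (2 * r). gagliardo_density s u y \<partial>lborel)"
proof -
  define \<omega> where "\<omega> = unit_ball_vol DIM('a)"
  have \<omega>: "\<omega> > 0" by (simp add: \<omega>_def)
  define m where "m = ball_average u x r"
  have "ennreal ((m - ball_average u x (2 * r))\<^sup>2) * ennreal (\<omega> * (2 * r) ^ DIM('a))
    \<le> (\<integral>\<^sup>+ y \<in> ball x (2 * r). ennreal ((u y - m)\<^sup>2) \<partial>lborel)"
    using ball_average_deviation_le[of u x "2 * r" m] int r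
    by (simp add: \<omega>_def power2_commute[of m])
  then have "ennreal ((m - ball_average u x (2 * r))\<^sup>2) * ennreal (\<omega> * (2 * r) ^ DIM('a)) * ennreal (\<omega> * r ^ DIM('a))
    \<le> (\<integral>\<^sup>+ y \<in> ball x (2 * r). ennreal ((u y - m)\<^sup>2) \<partial>lborel) * ennreal (\<omega> * r ^ DIM('a))"
    by (rule mult_right_mono) simp
  also have "\<dots> = (\<integral>\<^sup>+ y. ennreal ((u y - m)\<^sup>2) * indicator (ball x (2 * r)) y * ennreal (\<omega> * r ^ DIM('a)) \<partial>lborel)"
    by (rule nn_integral_multc[symmetric]) simp
  also have "\<dots> \<le> (\<integral>\<^sup>+ y. ennreal ((4 * r) powr (real DIM('a) + 2 * s))
      * (gagliardo_density s u y * indicator (ball x (2 * r)) y) \<partial>lborel)"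
  proof (rule nn_integral_mono)
    fix y :: 'a
    show "ennreal ((u y - m)\<^sup>2) * indicator (ball x (2 * r)) y * ennreal (\<omega> * r ^ DIM('a))
      \<le> ennreal ((4 * r) powr (real DIM('a) + 2 * s)) * (gagliardo_density s u y * indicator (ball x (2 * r)) y)"
    proof (cases "y \<in> ball x (2 * r)")
      case True
      \<comment> \<open>The distance is below \<open>r + 2 * r\<close>; \<open>4 * r\<close> is a
        convenient round bound.\<close>
      have D: "dist z y \<le> 4 * r" if "z \<in> ball x r" for z
        using that True dist_triangle[of z y x] r by (auto simp: dist_commute)
      have "ennreal ((m - u y)\<^sup>2) * ennreal (\<omega> * r ^ DIM('a))
          \<le> (\<integral>\<^sup>+ z \<in> ball x r. ennreal ((u z - u y)\<^sup>2) \<partial>lborel)"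
        unfolding m_def \<omega>_def using int r by (intro ball_average_deviation_le) simp_all
      also have "\<dots> \<le> ennreal ((4 * r) powr (real DIM('a) + 2 * s)) * gagliardo_density s u y"
        using D s by (intro nn_integral_sq_diff_le) simp_all
      finally show ?thesis using True by (simp add: power2_commute[of m])
    qed simp
  qed
  also have "\<dots> = ennreal ((4 * r) powr (real DIM('a) + 2 * s))
      * (\<integral>\<^sup>+ y \<in> ball x (2 * r). gagliardo_density s u y \<partial>lborel)"
    by (rule nn_integral_cmult) simp
  finally have *: "ennreal ((m - ball_average u x (2 * r))\<^sup>2)
      * (ennreal (\<omega> * (2 * r) ^ DIM('a)) * ennreal (\<omega> * r ^ DIM('a)))
    \<le> ennreal ((4 * r) powr (real DIM('a) + 2 * s))
      * (\<integral>\<^sup>+ y \<in> ball x (2 * r). gagliardo_density s u y \<partial>lborel)"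
    by (simp only: mult.assoc)
  have "\<omega> * (2 * r) ^ DIM('a) * (\<omega> * r ^ DIM('a)) = \<omega>\<^sup>2 * 2 ^ DIM('a) * r ^ (2 * DIM('a))"
    unfolding power_even_eq by (simp add: power2_eq_square power_mult_distrib mult_ac)
  then have "ennreal (\<omega> * (2 * r) ^ DIM('a)) * ennreal (\<omega> * r ^ DIM('a))
      = ennreal (\<omega>\<^sup>2 * 2 ^ DIM('a) * r ^ (2 * DIM('a)))"
    using \<omega> r by (simp flip: ennreal_mult)
  with * show ?thesis
    by (simp only: m_def \<omega>_def)
qed

text \<open>Telescoping: the steps are dominated by a geometric series, whose sum bounds the
  distance from \<open>a 0\<close> to the limit.\<close>

lemma abs_le_geometric_limit:
  fixes a :: "nat \<Rightarrow> real"
  assumes step: "\<And>k. \<bar>a (Suc k) - a k\<bar> \<le> A * \<theta> ^ k" and \<theta>: "0 \<le> \<theta>" "\<theta> < 1"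
    and lim: "a \<longlonglongrightarrow> L"
  shows "\<bar>a 0 - L\<bar> \<le> A / (1 - \<theta>)"
proof -
  have A: "0 \<le> A" using step[of 0] by auto
  \<comment> \<open>The right side is the exact partial sum of the series, which lets the induction
    close.\<close>
  have "\<bar>a 0 - a n\<bar> \<le> A / (1 - \<theta>) * (1 - \<theta> ^ n)" for n
  proof (induction n)
    case (Suc n)
    have "A / (1 - \<theta>) * (1 - \<theta> ^ Suc n) - A / (1 - \<theta>) * (1 - \<theta> ^ n)
        = A / (1 - \<theta>) * ((1 - \<theta> ^ Suc n) - (1 - \<theta> ^ n))"
      by (rule right_diff_distrib[symmetric])
    also have "(1 - \<theta> ^ Suc n) - (1 - \<theta> ^ n) = (1 - \<theta>) * \<theta> ^ n"
      by (simp add: algebra_simps)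
    also have "A / (1 - \<theta>) * ((1 - \<theta>) * \<theta> ^ n) = A * \<theta> ^ n"
      using \<theta> by simp
    finally have "A * \<theta> ^ n = A / (1 - \<theta>) * (1 - \<theta> ^ Suc n) - A / (1 - \<theta>) * (1 - \<theta> ^ n)" ..
    then show ?case using Suc step[of n] by linarith
  qed simp
  moreover have "A / (1 - \<theta>) * (1 - \<theta> ^ n) \<le> A / (1 - \<theta>) * 1" for n
    using A \<theta> by (intro mult_left_mono) simp_all
  ultimately have "\<bar>a 0 - a n\<bar> \<le> A / (1 - \<theta>)" for n
    by (metis mult.right_neutral order_trans)
  moreover have "(\<lambda>n. \<bar>a 0 - a n\<bar>) \<longlonglongrightarrow> \<bar>a 0 - L\<bar>"
    by (intro tendsto_intros lim)
  ultimately show ?thesis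
    by (intro LIMSEQ_le_const2) auto
qed

text \<open>Where t exceeds \<epsilon>, the factor \<open>(t / \<epsilon>) powr (p - 1)\<close> is
  at least 1. This splitting does the work of Hoelder's inequality for the averages.\<close>

lemma le_add_powr:
  fixes t \<epsilon> p :: real
  assumes "0 \<le> t" "0 < \<epsilon>" "1 \<le> p"
  shows "t \<le> \<epsilon> + \<epsilon> powr (1 - p) * t powr p"
proof (cases "t \<le> \<epsilon>")
  case False
  then have t: "t > 0" "\<epsilon> \<le> t" using assms by auto
  have "t = t powr (1 - p) * t powr p"
    using t by (simp flip: powr_add)
  also have "\<dots> \<le> \<epsilon> powr (1 - p) * t powr p"
    using t assms by (intro mult_right_mono powr_mono2') auto
  finally show ?thesis using assms by simp
qed (use assms in \<open>simp add: add_increasing2\<close>)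

lemma set_integrable_ball_of_powr:
  fixes u :: "'a::euclidean_space \<Rightarrow> real"
  assumes [measurable]: "u \<in> borel_measurable borel" and p: "1 \<le> p"
    and int: "integrable lborel (\<lambda>x. \<bar>u x\<bar> powr p)"
  shows "set_integrable lborel (ball x r) u"
  unfolding set_integrable_def
proof (rule Bochner_Integration.integrable_bound)
  have "integrable lborel (indicator (ball x r) :: 'a \<Rightarrow> real)"
    using emeasure_lborel_ball_finite[of x r] by (simp add: less_top)
  then show "integrable lborel (\<lambda>y. indicator (ball x r) y + \<bar>u y\<bar> powr p)"
    using int by (rule Bochner_Integration.integrable_add)
  show "AE y in lborel. norm (indicat_real (ball x r) y *\<^sub>R u y)
      \<le> norm (indicator (ball x r) y + \<bar>u y\<bar> powr p)"
  proof (rule AE_I2)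
    fix y
    show "norm (indicat_real (ball x r) y *\<^sub>R u y) \<le> norm (indicator (ball x r) y + \<bar>u y\<bar> powr p)"
      using le_add_powr[of "\<bar>u y\<bar>" 1 p] p by (simp add: indicator_def)
  qed
qed simp

text \<open>The bound tends to 0 as r grows, which identifies the limit of the averages over large
  balls.\<close>

lemma abs_ball_average_le:
  fixes u :: "'a::euclidean_space \<Rightarrow> real"
  assumes [measurable]: "u \<in> borel_measurable borel" and p: "1 \<le> p"
    and int: "integrable lborel (\<lambda>x. \<bar>u x\<bar> powr p)" and r: "0 < r"
  shows "\<bar>ball_average u x r\<bar>
    \<le> (1 + (\<integral>x. \<bar>u x\<bar> powr p \<partial>lborel) / unit_ball_vol DIM('a)) * r powr (- real DIM('a) / p)"
proof -
  define \<omega> where "\<omega> = unit_ball_vol DIM('a)"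
  have \<omega>: "\<omega> > 0" by (simp add: \<omega>_def)
  define I where "I = (\<integral>x. \<bar>u x\<bar> powr p \<partial>lborel)"
  \<comment> \<open>This choice balances the two terms:
    \<open>\<epsilon> powr (1 - p) * r powr (- N) = \<epsilon>\<close>, N being the
    dimension.\<close>
  define \<epsilon> where "\<epsilon> = r powr (- real DIM('a) / p)"
  have \<epsilon>: "\<epsilon> > 0" using r by (simp add: \<epsilon>_def)
  define B where "B = ball x r"
  have [measurable]: "B \<in> sets borel" by (simp add: B_def)
  have vol: "measure lborel B = \<omega> * r powr real DIM('a)"
    using r by (simp add: B_def \<omega>_def content_ball powr_realpow)
  have vol_pos: "measure lborel B > 0" using \<omega> r by (simp add: vol)
  have intB: "integrable lborel (indicator B :: 'a \<Rightarrow> real)"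
    unfolding B_def using emeasure_lborel_ball_finite[of x r] by (simp add: less_top)
  have intu: "integrable lborel (\<lambda>y. indicator B y * u y)"
    using set_integrable_ball_of_powr[OF _ p int, of x r] by (simp add: set_integrable_def B_def)
  have "\<bar>\<integral>y. indicator B y * u y \<partial>lborel\<bar> \<le> (\<integral>y. \<bar>indicator B y * u y\<bar> \<partial>lborel)"
    by (rule integral_abs_bound)
  also have "\<dots> \<le> (\<integral>y. \<epsilon> * indicator B y + \<epsilon> powr (1 - p) * \<bar>u y\<bar> powr p \<partial>lborel)"
  proof (rule integral_mono)
    fix y :: 'a
    show "\<bar>indicator B y * u y\<bar> \<le> \<epsilon> * indicator B y + \<epsilon> powr (1 - p) * \<bar>u y\<bar> powr p"
      using le_add_powr[of "\<bar>u y\<bar>" \<epsilon> p] p \<epsilon> by (auto simp: indicator_def)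
  qed (intro integrable_abs intu Bochner_Integration.integrable_add integrable_mult_right intB int)+
  also have "\<dots> = \<epsilon> * measure lborel B + \<epsilon> powr (1 - p) * I"
    using intB int by (simp add: I_def)
  finally have "\<bar>ball_average u x r\<bar> \<le> (\<epsilon> * measure lborel B + \<epsilon> powr (1 - p) * I) / measure lborel B"
    using vol_pos
    by (simp add: ball_average_def set_lebesgue_integral_def B_def[symmetric] divide_right_mono)
  also have "\<dots> = \<epsilon> + \<epsilon> powr (1 - p) * I / measure lborel B"
    using vol_pos by (simp add: add_divide_distrib)
  also have "\<epsilon> powr (1 - p) * I / measure lborel B
      = \<epsilon> powr (1 - p) * r powr (- real DIM('a)) * (I / \<omega>)"
    by (simp add: vol powr_minus divide_inverse mult_ac)
  also have "\<epsilon> powr (1 - p) * r powr (- real DIM('a)) = \<epsilon>"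
  proof -
    have "- real DIM('a) / p * (1 - p) + - real DIM('a) = - real DIM('a) / p"
      using p by (simp add: field_simps)
    then show ?thesis
      by (simp only: \<epsilon>_def powr_powr powr_add[symmetric])
  qed
  finally show ?thesis by (simp add: I_def \<omega>_def \<epsilon>_def algebra_simps)
qed

text \<open>Finite density at x bounds the squared deviation from \<open>u x\<close> by a multiple
  of \<open>r powr (N + 2 * s) / r ^ N = r powr (2 * s)\<close>, N being the dimension. So
  convergence holds at this very point.\<close>

lemma ball_average_tendsto:
  fixes u :: "'a::euclidean_space \<Rightarrow> real"
  assumes [measurable]: "u \<in> borel_measurable borel"
    and int: "\<And>r. set_integrable lborel (ball x r) u"
    and s: "s > 0" and fin: "gagliardo_density s u x < \<infinity>"
    and r: "r \<longlonglongrightarrow> 0" "\<And>k. r k > 0"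
  shows "(\<lambda>k. ball_average u x (r k)) \<longlonglongrightarrow> u x"
proof -
  define \<omega> where "\<omega> = unit_ball_vol DIM('a)"
  have \<omega>: "\<omega> > 0" by (simp add: \<omega>_def)
  obtain d where d: "gagliardo_density s u x = ennreal d" "d \<ge> 0"
    using fin by (cases "gagliardo_density s u x") auto
  have bound: "(ball_average u x (r k) - u x)\<^sup>2 \<le> d / \<omega> * r k powr (2 * s)" for k
  proof -
    have "ennreal ((ball_average u x (r k) - u x)\<^sup>2) * ennreal (\<omega> * r k ^ DIM('a))
      \<le> (\<integral>\<^sup>+ y \<in> ball x (r k). ennreal ((u y - u x)\<^sup>2) \<partial>lborel)"
      unfolding \<omega>_def using int r by (intro ball_average_deviation_le) auto
    also have "\<dots> \<le> ennreal (r k powr (real DIM('a) + 2 * s)) * gagliardo_density s u x"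
      using s by (intro nn_integral_sq_diff_le) (auto simp: dist_commute)
    finally have "(ball_average u x (r k) - u x)\<^sup>2 * (\<omega> * r k ^ DIM('a))
        \<le> r k powr (real DIM('a) + 2 * s) * d"
      using d \<omega> r(2)[of k] by (simp flip: ennreal_mult add: ennreal_le_iff)
    also have "r k powr (real DIM('a) + 2 * s) = r k ^ DIM('a) * r k powr (2 * s)"
      using r(2)[of k] by (simp add: powr_add powr_realpow)
    finally have "(ball_average u x (r k) - u x)\<^sup>2 * \<omega> * r k ^ DIM('a)
        \<le> r k powr (2 * s) * d * r k ^ DIM('a)"
      by (simp only: mult_ac)
    then have "(ball_average u x (r k) - u x)\<^sup>2 * \<omega> \<le> r k powr (2 * s) * d"
      using r(2)[of k] by (subst (asm) mult_le_cancel_right_pos) simp_all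
    then show ?thesis using \<omega> by (simp add: field_simps)
  qed
  have "(\<lambda>k. d / \<omega> * r k powr (2 * s)) \<longlonglongrightarrow> d / \<omega> * 0"
    using r(1) s less_imp_le[OF r(2)]
    by (intro tendsto_mult tendsto_const tendsto_zero_powrI[where b = "2 * s"] always_eventually allI) simp_all
  then have lim: "(\<lambda>k. d / \<omega> * r k powr (2 * s)) \<longlonglongrightarrow> 0" by simp
  have "(\<lambda>k. (ball_average u x (r k) - u x)\<^sup>2) \<longlonglongrightarrow> 0"
    by (rule real_tendsto_sandwich[OF _ _ tendsto_const lim]; intro always_eventually allI bound zero_le_power2)
  then have "(\<lambda>k. sqrt ((ball_average u x (r k) - u x)\<^sup>2)) \<longlonglongrightarrow> sqrt 0"
    by (rule tendsto_real_sqrt)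
  then have "(\<lambda>k. \<bar>ball_average u x (r k) - u x\<bar>) \<longlonglongrightarrow> 0"
    by simp
  then show ?thesis
    by (rule LIM_zero_cancel[OF tendsto_rabs_zero_cancel])
qed

text \<open>The density on the ball is bounded by its total mass. The kernel gives the exponent
  \<open>N + 2 * s\<close>, the two volumes take away \<open>2 * N\<close>; the result is negative
  when \<open>2 * s < N\<close>, so doubling radii give a convergent series.\<close>

lemma ball_average_diff_large:
  fixes u :: "'a::euclidean_space \<Rightarrow> real"
  assumes [measurable]: "u \<in> borel_measurable borel"
    and int: "\<And>r. set_integrable lborel (ball x r) u" and r: "0 < r" and s: "s > 0"
    and G: "(\<integral>\<^sup>+ x. gagliardo_density s u x \<partial>lborel) \<le> ennreal G" "G \<ge> 0"
  shows "(ball_average u x (2 * r) - ball_average u x r)\<^sup>2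
    \<le> 4 powr (real DIM('a) + 2 * s) / ((unit_ball_vol DIM('a))\<^sup>2 * 2 ^ DIM('a)) * G
      * r powr (2 * s - real DIM('a))"
proof -
  define \<omega> where "\<omega> = unit_ball_vol DIM('a)"
  have \<omega>: "\<omega> > 0" by (simp add: \<omega>_def)
  define a where "a = (ball_average u x (2 * r) - ball_average u x r)\<^sup>2"
  have "(\<integral>\<^sup>+ y \<in> ball x (2 * r). gagliardo_density s u y \<partial>lborel) \<le> (\<integral>\<^sup>+ x. gagliardo_density s u x \<partial>lborel)"
    by (intro nn_integral_mono) (auto simp: indicator_def)
  also note G(1)
  finally have J: "(\<integral>\<^sup>+ y \<in> ball x (2 * r). gagliardo_density s u y \<partial>lborel) \<le> ennreal G" .
  have "ennreal a * ennreal (\<omega>\<^sup>2 * 2 ^ DIM('a) * r ^ (2 * DIM('a)))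
      \<le> ennreal ((4 * r) powr (real DIM('a) + 2 * s))
        * (\<integral>\<^sup>+ y \<in> ball x (2 * r). gagliardo_density s u y \<partial>lborel)"
    using ball_average_diff_le[of u x r s] int r s
    by (simp add: a_def \<omega>_def power2_commute[of "ball_average u x r"])
  also have "\<dots> \<le> ennreal ((4 * r) powr (real DIM('a) + 2 * s)) * ennreal G"
    by (intro mult_left_mono J) simp
  finally have "ennreal a * ennreal (\<omega>\<^sup>2 * 2 ^ DIM('a) * r ^ (2 * DIM('a)))
      \<le> ennreal ((4 * r) powr (real DIM('a) + 2 * s)) * ennreal G" .
  then have "a * (\<omega>\<^sup>2 * 2 ^ DIM('a) * r ^ (2 * DIM('a))) \<le> (4 * r) powr (real DIM('a) + 2 * s) * G"
    using \<omega> r G(2) by (simp flip: ennreal_mult add: ennreal_le_iff a_def)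
  moreover have "(4 * r) powr (real DIM('a) + 2 * s)
      = 4 powr (real DIM('a) + 2 * s) * r powr (2 * s - real DIM('a)) * r ^ (2 * DIM('a))"
    using r by (simp add: powr_mult flip: powr_realpow powr_add)
  ultimately have "a * (\<omega>\<^sup>2 * 2 ^ DIM('a)) * r ^ (2 * DIM('a))
      \<le> 4 powr (real DIM('a) + 2 * s) * r powr (2 * s - real DIM('a)) * G * r ^ (2 * DIM('a))"
    by (simp add: mult_ac)
  then have "a * (\<omega>\<^sup>2 * 2 ^ DIM('a)) \<le> 4 powr (real DIM('a) + 2 * s) * r powr (2 * s - real DIM('a)) * G"
    using r by (subst (asm) mult_le_cancel_right_pos) simp_all
  then have "a \<le> 4 powr (real DIM('a) + 2 * s) * r powr (2 * s - real DIM('a)) * G / (\<omega>\<^sup>2 * 2 ^ DIM('a))"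
    using \<omega> by (subst pos_le_divide_eq) simp_all
  then show ?thesis by (simp add: a_def \<omega>_def mult_ac)
qed

text \<open>Radiality of the density gains a factor of order \<open>(r / norm x) ^ (N - 1)\<close>
  over the preceding bound and turns the exponent \<open>2 * s - N\<close> of r into
  \<open>2 * s - 1\<close>. This is positive when \<open>s > 1/2\<close>, so halving radii give a
  convergent series.\<close>

lemma ball_average_diff_small:
  fixes u :: "'a::euclidean_space \<Rightarrow> real"
  assumes [measurable]: "u \<in> borel_measurable borel" and u: "radial u"
    and int: "\<And>r. set_integrable lborel (ball x r) u" and r: "0 < r" and s: "s > 0"
    and G: "(\<integral>\<^sup>+ x. gagliardo_density s u x \<partial>lborel) \<le> ennreal G" "G \<ge> 0"
    and x: "x \<noteq> 0"
  shows "(ball_average u x (2 * r) - ball_average u x r)\<^sup>2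
    \<le> 4 powr (2 * real DIM('a) + 2 * s) / ((unit_ball_vol DIM('a))\<^sup>2 * 2 ^ DIM('a) * 2) * G
      * (r powr (2 * s - 1) * norm x powr (1 - real DIM('a)))"
proof -
  define \<omega> where "\<omega> = unit_ball_vol DIM('a)"
  have \<omega>: "\<omega> > 0" by (simp add: \<omega>_def)
  define a where "a = (ball_average u x (2 * r) - ball_average u x r)\<^sup>2"
  define J where "J = (\<integral>\<^sup>+ y \<in> ball x (2 * r). gagliardo_density s u y \<partial>lborel)"
  \<comment> \<open>The left factor of \<open>nn_integral_ball_radial_le\<close> for
    \<open>d = 2 * r\<close>. Multiplying by it avoids a division in \<open>ennreal\<close>.\<close>
  define P where "P = 2 * r * norm x ^ (DIM('a) - 1)"
  have P: "P > 0" using r x by (simp add: P_def)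
  have J: "J * ennreal P \<le> ennreal ((4 * r) ^ DIM('a)) * ennreal G"
  proof -
    have "J * ennreal P \<le> ennreal ((2 * (2 * r)) ^ DIM('a)) * (\<integral>\<^sup>+ x. gagliardo_density s u x \<partial>lborel)"
      unfolding J_def P_def using r x
      by (intro nn_integral_ball_radial_le gagliardo_density_orthogonal u) simp_all
    also have "\<dots> \<le> ennreal ((2 * (2 * r)) ^ DIM('a)) * ennreal G"
      by (intro mult_left_mono G) simp
    finally show ?thesis by simp
  qed
  have "ennreal a * ennreal (\<omega>\<^sup>2 * 2 ^ DIM('a) * r ^ (2 * DIM('a)))
      \<le> ennreal ((4 * r) powr (real DIM('a) + 2 * s)) * J"
    using ball_average_diff_le[of u x r s] int r s
    by (simp add: a_def \<omega>_def J_def power2_commute[of "ball_average u x r"])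
  then have "ennreal a * ennreal (\<omega>\<^sup>2 * 2 ^ DIM('a) * r ^ (2 * DIM('a))) * ennreal P
      \<le> ennreal ((4 * r) powr (real DIM('a) + 2 * s)) * J * ennreal P"
    by (rule mult_right_mono) simp
  also have "\<dots> \<le> ennreal ((4 * r) powr (real DIM('a) + 2 * s)) * (ennreal ((4 * r) ^ DIM('a)) * ennreal G)"
    unfolding mult.assoc by (intro mult_left_mono J) simp
  finally have 1: "a * (\<omega>\<^sup>2 * 2 ^ DIM('a) * r ^ (2 * DIM('a))) * P
      \<le> (4 * r) powr (real DIM('a) + 2 * s) * ((4 * r) ^ DIM('a) * G)"
    using \<omega> r G(2) P by (simp flip: ennreal_mult add: ennreal_le_iff a_def)
  \<comment> \<open>The exponent is split as \<open>2 * N + 2 * s = (2 * s - 1) + 2 * N + 1\<close>;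
    the last two parts cancel against the volumes and the r in P.\<close>
  have 2: "(4 * r) powr (real DIM('a) + 2 * s) * (4 * r) ^ DIM('a)
      = 4 powr (2 * real DIM('a) + 2 * s) * r powr (2 * s - 1) * r ^ (2 * DIM('a)) * r"
  proof -
    have "(4 * r) ^ DIM('a) = (4 * r) powr real DIM('a)"
      using powr_realpow[of "4 * r" "DIM('a)"] r by simp
    moreover have "real DIM('a) + 2 * s + real DIM('a) = 2 * real DIM('a) + 2 * s" by simp
    ultimately have "(4 * r) powr (real DIM('a) + 2 * s) * (4 * r) ^ DIM('a) = (4 * r) powr (2 * real DIM('a) + 2 * s)"
      by (simp only: powr_add[symmetric])
    also have "\<dots> = 4 powr (2 * real DIM('a) + 2 * s) * r powr ((2 * s - 1) + real (2 * DIM('a)) + 1)"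
      using r by (simp add: powr_mult add_ac)
    also have "r powr ((2 * s - 1) + real (2 * DIM('a)) + 1) = r powr (2 * s - 1) * r ^ (2 * DIM('a)) * r"
      using r unfolding powr_add by (simp only: powr_realpow powr_one)
    finally show ?thesis by (simp add: mult_ac)
  qed
  have 3: "norm x ^ (DIM('a) - 1) * norm x powr (1 - real DIM('a)) = 1"
  proof -
    have "norm x ^ (DIM('a) - 1) = norm x powr (real DIM('a) - 1)"
      using x DIM_positive[where 'a='a] by (simp add: of_nat_diff Suc_le_eq flip: powr_realpow)
    then show ?thesis using x by (simp flip: powr_add)
  qed
  have "a * (\<omega>\<^sup>2 * 2 ^ DIM('a) * 2) * (r ^ (2 * DIM('a)) * r * norm x ^ (DIM('a) - 1))
      = a * (\<omega>\<^sup>2 * 2 ^ DIM('a) * r ^ (2 * DIM('a))) * P"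
    by (simp only: P_def mult_ac)
  also note 1
  also have "(4 * r) powr (real DIM('a) + 2 * s) * ((4 * r) ^ DIM('a) * G)
      = (4 * r) powr (real DIM('a) + 2 * s) * (4 * r) ^ DIM('a) * G
        * (norm x ^ (DIM('a) - 1) * norm x powr (1 - real DIM('a)))"
    by (simp only: 3 mult.assoc mult_1_right)
  also have "\<dots> = 4 powr (2 * real DIM('a) + 2 * s) * r powr (2 * s - 1) * G * norm x powr (1 - real DIM('a))
        * (r ^ (2 * DIM('a)) * r * norm x ^ (DIM('a) - 1))"
    unfolding 2 by (simp only: mult_ac)
  finally have "a * (\<omega>\<^sup>2 * 2 ^ DIM('a) * 2)
      \<le> 4 powr (2 * real DIM('a) + 2 * s) * r powr (2 * s - 1) * G * norm x powr (1 - real DIM('a))"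
    using r x by (subst (asm) mult_le_cancel_right_pos) simp_all
  then have "a \<le> 4 powr (2 * real DIM('a) + 2 * s) * r powr (2 * s - 1) * G * norm x powr (1 - real DIM('a))
      / (\<omega>\<^sup>2 * 2 ^ DIM('a) * 2)"
    using \<omega> by (subst pos_le_divide_eq) simp_all
  then show ?thesis by (simp add: a_def \<omega>_def mult_ac)
qed

subsection \<open>The radial pointwise estimate\<close>

text \<open>The two summands are the sums of the geometric series over the small and the large balls.\<close>
definition strauss_const :: "nat \<Rightarrow> real \<Rightarrow> real" where
  "strauss_const N s =
     sqrt (4 powr (2 * real N + 2 * s) / ((unit_ball_vol N)\<^sup>2 * 2 ^ N * 2)) / (1 - (1/2) powr (s - 1/2))
     + sqrt (4 powr (real N + 2 * s) / ((unit_ball_vol N)\<^sup>2 * 2 ^ N)) / (1 - 2 powr (s - real N / 2))"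

lemma power_powr: "0 < b \<Longrightarrow> (b ^ k) powr t = (b powr t) ^ k" for b t :: real
  by (induction k) (simp_all add: powr_mult)

lemma powr_sq: "(b powr t)\<^sup>2 = b powr (2 * t)" for b t :: real
  by (simp add: power2_eq_square flip: powr_add)

lemma abs_le_sqrt_mult:
  fixes y :: real
  assumes "y\<^sup>2 \<le> c * z\<^sup>2" "0 \<le> z"
  shows "\<bar>y\<bar> \<le> sqrt c * z"
  using real_sqrt_le_mono[OF assms(1)] assms(2) by (simp add: real_sqrt_mult)

lemma radial_bound_at:
  fixes u :: "'a::euclidean_space \<Rightarrow> real"
  assumes [measurable]: "u \<in> borel_measurable borel" and u: "radial u"
    and p: "1 \<le> p" and int: "integrable lborel (\<lambda>x. \<bar>u x\<bar> powr p)"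
    and s: "1/2 < s" "2 * s < real DIM('a)"
    and G: "(\<integral>\<^sup>+ x. gagliardo_density s u x \<partial>lborel) \<le> ennreal G" "G \<ge> 0"
    and x: "x \<noteq> 0" and fin: "gagliardo_density s u x < \<infinity>"
  shows "\<bar>u x\<bar> \<le> strauss_const DIM('a) s * sqrt G * norm x powr (s - real DIM('a) / 2)"
proof -
  define \<rho> where "\<rho> = norm x"
  have \<rho>: "\<rho> > 0" using x by (simp add: \<rho>_def)
  define N where "N = real DIM('a)"
  define c1 where "c1 = 4 powr (2 * N + 2 * s) / ((unit_ball_vol N)\<^sup>2 * 2 ^ DIM('a) * 2)"
  define c2 where "c2 = 4 powr (N + 2 * s) / ((unit_ball_vol N)\<^sup>2 * 2 ^ DIM('a))"
  \<comment> \<open>The ratios of the two series: square roots of the factors by which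
    \<open>r powr (2 * s - 1)\<close> changes under halving and \<open>r powr (2 * s - N)\<close>
    under doubling of r. The two bounds on s put them below 1.\<close>
  define \<theta>1 where "\<theta>1 = (1/2) powr (s - 1/2)"
  define \<theta>2 where "\<theta>2 = 2 powr (s - N / 2)"
  have \<theta>1: "0 \<le> \<theta>1" "\<theta>1 < 1"
    using s powr_less_mono'[of "1/2" 0 "s - 1/2"] by (simp_all add: \<theta>1_def)
  have \<theta>2: "0 \<le> \<theta>2" "\<theta>2 < 1"
    using s powr_less_mono[of "s - N / 2" 0 2] by (simp_all add: \<theta>2_def N_def)
  have s0: "s > 0" using s by simp
  have c1: "c1 \<ge> 0" and c2: "c2 \<ge> 0" by (simp_all add: c1_def c2_def)
  note intb = set_integrable_ball_of_powr[OF assms(1) p int]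
  define Z where "Z = \<rho> powr (s - N / 2)"
  \<comment> \<open>The first factorisation fits the bound for small balls, the second the one for
    large balls.\<close>
  have Z: "Z\<^sup>2 = \<rho> powr (2 * s - 1) * \<rho> powr (1 - N)" "Z\<^sup>2 = \<rho> powr (2 * s - N)" "Z \<ge> 0"
    by (simp_all add: Z_def powr_sq algebra_simps flip: powr_add)

  define a where "a k = ball_average u x (\<rho> * (1/2) ^ k)" for k
  have "\<bar>a 0 - u x\<bar> \<le> sqrt (c1 * G) * Z / (1 - \<theta>1)"
  proof (rule abs_le_geometric_limit[OF _ \<theta>1])
    fix k
    define r where "r = \<rho> * (1/2) ^ Suc k"
    have r: "r > 0" "2 * r = \<rho> * (1/2) ^ k" using \<rho> by (simp_all add: r_def)
    have a_eq: "a k = ball_average u x (2 * r)" "a (Suc k) = ball_average u x r"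
      unfolding r(2) by (simp_all only: a_def r_def)
    have "(a k - a (Suc k))\<^sup>2 \<le> c1 * G * (r powr (2 * s - 1) * \<rho> powr (1 - N))"
      using ball_average_diff_small[OF assms(1) u intb r(1) s0 G x]
      by (simp only: a_eq c1_def N_def \<rho>_def)
    \<comment> \<open>Enlarging r to \<open>2 * r\<close>, as \<open>2 * s - 1 > 0\<close> permits,
      yields the power k of the ratio instead of \<open>Suc k\<close>.\<close>
    also have "\<dots> \<le> c1 * G * ((2 * r) powr (2 * s - 1) * \<rho> powr (1 - N))"
      using r s c1 G(2) by (intro mult_left_mono mult_right_mono powr_mono2) auto
    also have "(2 * r) powr (2 * s - 1) = \<rho> powr (2 * s - 1) * (\<theta>1 ^ k)\<^sup>2"
    proof -
      have "((1/2) ^ k) powr (2 * s - 1) = ((1/2) powr (2 * (s - 1/2))) ^ k"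
        by (simp add: power_powr algebra_simps)
      also have "\<dots> = (\<theta>1 ^ k)\<^sup>2"
        unfolding \<theta>1_def by (simp only: powr_sq[symmetric] power_mult[symmetric] mult.commute)
      finally show ?thesis unfolding r(2) using \<rho> by (simp add: powr_mult)
    qed
    also have "c1 * G * (\<rho> powr (2 * s - 1) * (\<theta>1 ^ k)\<^sup>2 * \<rho> powr (1 - N)) = c1 * G * (Z * \<theta>1 ^ k)\<^sup>2"
      unfolding power_mult_distrib[of Z] Z(1) by (simp only: mult_ac)
    finally have "\<bar>a k - a (Suc k)\<bar> \<le> sqrt (c1 * G) * (Z * \<theta>1 ^ k)"
      using Z(3) \<theta>1 by (intro abs_le_sqrt_mult) simp_all
    then show "\<bar>a (Suc k) - a k\<bar> \<le> sqrt (c1 * G) * Z * \<theta>1 ^ k"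
      by (simp add: abs_minus_commute mult_ac)
  next
    have "(\<lambda>k. \<rho> * (1/2) ^ k) \<longlonglongrightarrow> \<rho> * 0"
      by (intro tendsto_mult tendsto_const LIMSEQ_power_zero) simp
    then show "a \<longlonglongrightarrow> u x"
      unfolding a_def using \<rho> by (intro ball_average_tendsto[OF assms(1) intb s0 fin]) simp_all
  qed
  moreover define b where "b k = ball_average u x (\<rho> * 2 ^ k)" for k
  have "\<bar>b 0 - 0\<bar> \<le> sqrt (c2 * G) * Z / (1 - \<theta>2)"
  proof (rule abs_le_geometric_limit[OF _ \<theta>2])
    fix k
    define r where "r = \<rho> * 2 ^ k"
    have r: "r > 0" "2 * r = \<rho> * 2 ^ Suc k" using \<rho> by (simp_all add: r_def)
    have "(b (Suc k) - b k)\<^sup>2 \<le> c2 * G * r powr (2 * s - N)"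
      using ball_average_diff_large[OF assms(1) intb r(1) s0 G]
      by (simp only: b_def r_def[symmetric] r(2)[symmetric] c2_def N_def)
    also have "r powr (2 * s - N) = \<rho> powr (2 * s - N) * (\<theta>2 ^ k)\<^sup>2"
    proof -
      have "(2 ^ k) powr (2 * s - N) = (2 powr (2 * (s - N / 2))) ^ k"
        by (simp add: power_powr algebra_simps)
      also have "\<dots> = (\<theta>2 ^ k)\<^sup>2"
        unfolding \<theta>2_def by (simp only: powr_sq[symmetric] power_mult[symmetric] mult.commute)
      finally show ?thesis unfolding r_def using \<rho> by (simp add: powr_mult)
    qed
    also have "c2 * G * (\<rho> powr (2 * s - N) * (\<theta>2 ^ k)\<^sup>2) = c2 * G * (Z * \<theta>2 ^ k)\<^sup>2"
      unfolding power_mult_distrib[of Z] Z(2) ..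
    finally have "\<bar>b (Suc k) - b k\<bar> \<le> sqrt (c2 * G) * (Z * \<theta>2 ^ k)"
      using Z(3) \<theta>2 by (intro abs_le_sqrt_mult) simp_all
    then show "\<bar>b (Suc k) - b k\<bar> \<le> sqrt (c2 * G) * Z * \<theta>2 ^ k"
      by (simp add: mult_ac)
  next
    \<comment> \<open>By \<open>abs_ball_average_le\<close> the averages over doubling radii decay
      like \<open>q ^ k\<close>, whence the limit 0.\<close>
    define C where "C = 1 + (\<integral>x. \<bar>u x\<bar> powr p \<partial>lborel) / unit_ball_vol N"
    define q where "q = 2 powr (- N / p)"
    have "q < 1"
      using p powr_less_mono[of "- N / p" 0 2] by (simp add: q_def N_def divide_neg_pos)
    then have "(\<lambda>k. C * \<rho> powr (- N / p) * q ^ k) \<longlonglongrightarrow> C * \<rho> powr (- N / p) * 0"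
      by (intro tendsto_mult tendsto_const LIMSEQ_power_zero) (simp add: q_def)
    then have "(\<lambda>k. C * \<rho> powr (- N / p) * q ^ k) \<longlonglongrightarrow> 0" by simp
    moreover have "norm (b k) \<le> C * \<rho> powr (- N / p) * q ^ k" for k
    proof -
      have "norm (b k) \<le> C * (\<rho> * 2 ^ k) powr (- N / p)"
        unfolding b_def C_def N_def real_norm_def using \<rho> p int
        by (intro abs_ball_average_le) simp_all
      also have "(\<rho> * 2 ^ k) powr (- N / p) = \<rho> powr (- N / p) * q ^ k"
        unfolding q_def using \<rho> by (simp only: powr_mult power_powr zero_less_numeral)
      finally show ?thesis by (simp only: mult.assoc)
    qed
    ultimately show "b \<longlonglongrightarrow> 0"
      by (intro Lim_null_comparison[where f = b, OF always_eventually]) auto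
  qed
  \<comment> \<open>Both chains start at radius \<open>norm x\<close>, so together they link
    \<open>u x\<close> to 0.\<close>
  moreover have "a 0 = b 0" by (simp add: a_def b_def)
  ultimately have "\<bar>u x\<bar> \<le> sqrt (c1 * G) * Z / (1 - \<theta>1) + sqrt (c2 * G) * Z / (1 - \<theta>2)"
    by linarith
  also have "\<dots> = (sqrt c1 / (1 - \<theta>1) + sqrt c2 / (1 - \<theta>2)) * sqrt G * Z"
    by (simp add: real_sqrt_mult algebra_simps)
  also have "sqrt c1 / (1 - \<theta>1) + sqrt c2 / (1 - \<theta>2) = strauss_const DIM('a) s"
    by (simp only: strauss_const_def c1_def c2_def \<theta>1_def \<theta>2_def N_def)
  finally show ?thesis by (simp only: Z_def N_def \<rho>_def)
qed

text \<open>A density of finite integral is finite almost everywhere, and the origin is a null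
  set.\<close>

lemma radial_bound_AE:
  fixes u :: "'a::euclidean_space \<Rightarrow> real"
  assumes u: "u \<in> borel_measurable borel" "radial u"
    and p: "1 \<le> p" and int: "integrable lborel (\<lambda>x. \<bar>u x\<bar> powr p)"
    and s: "1/2 < s" "2 * s < real DIM('a)"
    and G: "(\<integral>\<^sup>+ x. gagliardo_density s u x \<partial>lborel) \<le> ennreal G" "G \<ge> 0"
  shows "AE x in lborel. \<bar>u x\<bar> \<le> strauss_const DIM('a) s * sqrt G * norm x powr (s - real DIM('a) / 2)"
proof -
  have "(\<integral>\<^sup>+ x. gagliardo_density s u x \<partial>lborel) \<noteq> \<infinity>"
    using G(1) by (auto simp: top_unique)
  then have "AE x in lborel. gagliardo_density s u x \<noteq> \<infinity>"
    using u by (intro nn_integral_PInf_AE) simp_all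
  with AE_lborel_singleton[of "0::'a"] show ?thesis
    by eventually_elim (rule radial_bound_at[OF u p int s G], auto simp: less_top)
qed

lemma strauss_const_nonneg:
  assumes "1/2 < s" "2 * s < real N"
  shows "0 \<le> strauss_const N s"
proof -
  have "(1/2) powr (s - 1/2) < (1::real)" "2 powr (s - real N / 2) < (1::real)"
    using assms powr_less_mono'[of "1/2" 0 "s - 1/2"] powr_less_mono[of "s - real N / 2" 0 2] by simp_all
  then show ?thesis by (simp add: strauss_const_def)
qed

subsection \<open>Integrals of powers of the norm\<close>

text \<open>\<open>Suc k\<close> is the least n with \<open>t < 2 ^ n\<close>;
  \<open>1 \<le> t\<close> excludes \<open>n = 0\<close>.\<close>

lemma dyadic_bracket:
  fixes t :: real
  assumes "1 \<le> t"
  obtains k :: nat where "2 ^ k \<le> t" "t \<le> 2 ^ Suc k"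
proof -
  obtain n :: nat where "t < 2 ^ n" using real_arch_pow[of 2 t] by auto
  then have n: "\<exists>n. t < 2 ^ n" by blast
  define m where "m = (LEAST n. t < 2 ^ n)"
  have m: "t < 2 ^ m" unfolding m_def by (rule LeastI_ex[OF n])
  have "m \<noteq> 0" using m assms by (cases m) auto
  then obtain k where k: "m = Suc k" by (cases m) auto
  have "\<not> t < 2 ^ k" unfolding m_def[symmetric] using not_less_Least[of k "\<lambda>n. t < 2 ^ n"] k
    by (simp add: m_def)
  then show ?thesis using that[of k] m by (simp add: k)
qed

text \<open>On the shell the integrand is comparable to \<open>a powr \<kappa>\<close>; the factor
  \<open>2 powr \<bar>\<kappa>\<bar>\<close> covers both signs of the exponent.\<close>

lemma nn_integral_norm_powr_shell_le:
  fixes a \<kappa> :: real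
  assumes a: "a > 0"
  shows "(\<integral>\<^sup>+ x. ennreal (norm x powr \<kappa>) * indicator {x::'a::euclidean_space. a \<le> norm x \<and> norm x \<le> 2 * a} x \<partial>lborel)
    \<le> ennreal (2 powr \<bar>\<kappa>\<bar> * unit_ball_vol DIM('a) * 2 ^ DIM('a) * a powr (\<kappa> + real DIM('a)))"
proof -
  define S where "S = {x::'a. a \<le> norm x \<and> norm x \<le> 2 * a}"
  have "(\<integral>\<^sup>+ x. ennreal (norm x powr \<kappa>) * indicator S x \<partial>lborel)
    \<le> (\<integral>\<^sup>+ x. ennreal (2 powr \<bar>\<kappa>\<bar> * a powr \<kappa>) * indicator (cball (0::'a) (2 * a)) x \<partial>lborel)"
  proof (rule nn_integral_mono)
    fix x :: 'a
    show "ennreal (norm x powr \<kappa>) * indicator S x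
      \<le> ennreal (2 powr \<bar>\<kappa>\<bar> * a powr \<kappa>) * indicator (cball 0 (2 * a)) x"
    proof (cases "x \<in> S")
      case True
      then have x: "a \<le> norm x" "norm x \<le> 2 * a" by (auto simp: S_def)
      have "norm x powr \<kappa> \<le> 2 powr \<bar>\<kappa>\<bar> * a powr \<kappa>"
      proof (cases "\<kappa> \<ge> 0")
        case True
        have "norm x powr \<kappa> \<le> (2 * a) powr \<kappa>"
          using x a True by (intro powr_mono2) auto
        then show ?thesis using True a by (simp add: powr_mult)
      next
        case False
        have "norm x powr \<kappa> \<le> a powr \<kappa>"
          using x a False by (intro powr_mono2') auto
        also have "\<dots> \<le> 2 powr \<bar>\<kappa>\<bar> * a powr \<kappa>"
          using ge_one_powr_ge_zero[of 2 "\<bar>\<kappa>\<bar>"] by (simp add: mult_le_cancel_right1)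
        finally show ?thesis .
      qed
      then show ?thesis using x by (simp add: S_def ennreal_leI)
    qed simp
  qed
  also have "\<dots> = ennreal (2 powr \<bar>\<kappa>\<bar> * a powr \<kappa>) * ennreal (unit_ball_vol DIM('a) * (2 * a) ^ DIM('a))"
    using a by (subst nn_integral_cmult_indicator) (simp_all add: emeasure_cball)
  also have "\<dots> = ennreal (2 powr \<bar>\<kappa>\<bar> * a powr \<kappa> * (unit_ball_vol DIM('a) * (2 * a) ^ DIM('a)))"
    using a by (simp add: ennreal_mult)
  also have "2 powr \<bar>\<kappa>\<bar> * a powr \<kappa> * (unit_ball_vol DIM('a) * (2 * a) ^ DIM('a))
      = 2 powr \<bar>\<kappa>\<bar> * unit_ball_vol DIM('a) * 2 ^ DIM('a) * a powr (\<kappa> + real DIM('a))"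
    using a by (simp add: powr_add powr_realpow power_mult_distrib)
  finally show ?thesis by (simp add: S_def)
qed

text \<open>The set is covered by dyadic shells, each contributing a term of a geometric series. The
  radii may decrease or increase, so this serves both the origin and infinity.\<close>

lemma nn_integral_norm_powr_dyadic_le:
  fixes a :: "nat \<Rightarrow> real" and c q \<kappa> :: real and A :: "'a::euclidean_space set"
  assumes a: "\<And>k. a k > 0" "\<And>k. a k powr (\<kappa> + real DIM('a)) = c * q ^ k"
    and q: "0 \<le> q" "q < 1" and c: "0 \<le> c"
    and A: "\<And>x. x \<in> A \<Longrightarrow> \<exists>k. a k \<le> norm x \<and> norm x \<le> 2 * a k"
  shows "(\<integral>\<^sup>+ x. ennreal (norm x powr \<kappa>) * indicator A x \<partial>lborel)
    \<le> ennreal (2 powr \<bar>\<kappa>\<bar> * unit_ball_vol DIM('a) * 2 ^ DIM('a) * c / (1 - q))"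
proof -
  define S where "S k = {x::'a. a k \<le> norm x \<and> norm x \<le> 2 * a k}" for k
  have [measurable]: "S k \<in> sets borel" for k
    unfolding S_def by measurable
  define D where "D = 2 powr \<bar>\<kappa>\<bar> * unit_ball_vol DIM('a) * 2 ^ DIM('a)"
  have D: "D \<ge> 0" by (simp add: D_def)
  have "(\<integral>\<^sup>+ x. ennreal (norm x powr \<kappa>) * indicator A x \<partial>lborel)
    \<le> (\<integral>\<^sup>+ x. (\<Sum>k. ennreal (norm x powr \<kappa>) * indicator (S k) x) \<partial>lborel)"
  proof (rule nn_integral_mono)
    fix x :: 'a
    show "ennreal (norm x powr \<kappa>) * indicator A x \<le> (\<Sum>k. ennreal (norm x powr \<kappa>) * indicator (S k) x)"
    proof (cases "x \<in> A")
      case True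
      then obtain k where k: "x \<in> S k" using A by (auto simp: S_def)
      have "(\<Sum>k\<in>{k}. ennreal (norm x powr \<kappa>) * indicator (S k) x)
          \<le> (\<Sum>k. ennreal (norm x powr \<kappa>) * indicator (S k) x)"
        by (rule sum_le_suminf) auto
      then show ?thesis using True k by simp
    qed simp
  qed
  also have "\<dots> = (\<Sum>k. \<integral>\<^sup>+ x. ennreal (norm x powr \<kappa>) * indicator (S k) x \<partial>lborel)"
    by (rule nn_integral_suminf) measurable
  also have "\<dots> \<le> (\<Sum>k. ennreal (D * c * q ^ k))"
  proof (rule suminf_le)
    fix k
    show "(\<integral>\<^sup>+ x. ennreal (norm x powr \<kappa>) * indicator (S k) x \<partial>lborel) \<le> ennreal (D * c * q ^ k)"
      using nn_integral_norm_powr_shell_le[OF a(1)[of k], where 'a='a and \<kappa>=\<kappa>]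
      unfolding a(2) S_def D_def by (simp only: mult.assoc)
  qed auto
  also have "\<dots> = ennreal (\<Sum>k. D * c * q ^ k)"
    using D c q by (intro suminf_ennreal2 summable_mult summable_geometric) auto
  also have "(\<Sum>k. D * c * q ^ k) = D * c / (1 - q)"
    using q by (simp add: suminf_mult suminf_geometric summable_geometric)
  finally show ?thesis by (simp add: D_def)
qed

lemma nn_integral_norm_powr_ball_le:
  assumes \<kappa>: "\<kappa> > - real DIM('a::euclidean_space)"
  obtains C where "0 \<le> C" "\<And>R. R > 0 \<Longrightarrow>
    (\<integral>\<^sup>+ x \<in> ball (0::'a) R. ennreal (norm x powr \<kappa>) \<partial>lborel) \<le> ennreal (C * R powr (\<kappa> + real DIM('a)))"
proof
  define t where "t = \<kappa> + real DIM('a)"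
  have t: "t > 0" using \<kappa> by (simp add: t_def)
  define q where "q = (1/2) powr t"
  have q: "0 \<le> q" "q < 1"
    using t powr_less_mono'[of "1/2" 0 t] by (simp_all add: q_def)
  define D where "D = 2 powr \<bar>\<kappa>\<bar> * unit_ball_vol DIM('a) * 2 ^ DIM('a)"
  show "0 \<le> D * q / (1 - q)" using q by (simp add: D_def)
  fix R :: real
  assume R: "R > 0"
  \<comment> \<open>The origin lies in no shell. Removing it changes nothing, since
    \<open>0 powr \<kappa> = 0\<close>.\<close>
  have "(\<integral>\<^sup>+ x. ennreal (norm x powr \<kappa>) * indicator (ball (0::'a) R) x \<partial>lborel)
      = (\<integral>\<^sup>+ x. ennreal (norm x powr \<kappa>) * indicator (ball (0::'a) R - {0}) x \<partial>lborel)"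
    by (intro nn_integral_cong) (auto simp: indicator_def)
  also have "\<dots> \<le> ennreal (2 powr \<bar>\<kappa>\<bar> * unit_ball_vol DIM('a) * 2 ^ DIM('a) * (R powr t * q) / (1 - q))"
  \<comment> \<open>The exponent is \<open>Suc k\<close> because shell k reaches out to twice its
    inner radius; the outermost one ends at R.\<close>
  proof (rule nn_integral_norm_powr_dyadic_le[where a = "\<lambda>k. R * (1/2) ^ Suc k"])
    fix k
    show "R * (1/2) ^ Suc k > 0" using R by simp
    show "(R * (1/2) ^ Suc k) powr (\<kappa> + real DIM('a)) = R powr t * q * q ^ k"
      using power_powr[of "1/2" "Suc k" t] R
      by (simp add: powr_mult q_def t_def del: power_Suc) simp
  next
    fix x :: 'a
    assume "x \<in> ball 0 R - {0}"
    then have x: "0 < norm x" "norm x < R" by auto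
    then obtain k where k: "2 ^ k \<le> R / norm x" "R / norm x \<le> 2 ^ Suc k"
      using dyadic_bracket[of "R / norm x"] by auto
    then have "R * (1/2) ^ Suc k \<le> norm x \<and> norm x \<le> 2 * (R * (1/2) ^ Suc k)"
      using x by (simp add: field_simps power_one_over)
    then show "\<exists>k. R * (1/2) ^ Suc k \<le> norm x \<and> norm x \<le> 2 * (R * (1/2) ^ Suc k)" ..
  qed (use q R in auto)
  finally show "(\<integral>\<^sup>+ x \<in> ball (0::'a) R. ennreal (norm x powr \<kappa>) \<partial>lborel)
      \<le> ennreal (D * q / (1 - q) * R powr (\<kappa> + real DIM('a)))"
    by (simp add: D_def t_def mult_ac)
qed

lemma nn_integral_norm_powr_outside_ball_finite:
  assumes \<kappa>: "\<kappa> < - real DIM('a::euclidean_space)"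
  shows "(\<integral>\<^sup>+ x. ennreal (norm x powr \<kappa>) * indicator (- ball (0::'a) 1) x \<partial>lborel) < \<infinity>"
proof -
  define t where "t = \<kappa> + real DIM('a)"
  have t: "t < 0" using \<kappa> by (simp add: t_def)
  define q where "q = 2 powr t"
  have q: "0 \<le> q" "q < 1"
    using t powr_less_mono[of t 0 2] by (simp_all add: q_def)
  have "(\<integral>\<^sup>+ x. ennreal (norm x powr \<kappa>) * indicator (- ball (0::'a) 1) x \<partial>lborel)
      \<le> ennreal (2 powr \<bar>\<kappa>\<bar> * unit_ball_vol DIM('a) * 2 ^ DIM('a) * 1 / (1 - q))"
  proof (rule nn_integral_norm_powr_dyadic_le[where a = "\<lambda>k. 2 ^ k"])
    fix k
    show "(2 ^ k) powr (\<kappa> + real DIM('a)) = 1 * q ^ k"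
      using power_powr[of 2 k t] by (simp add: q_def t_def)
  next
    fix x :: 'a
    assume "x \<in> - ball 0 1"
    then have "1 \<le> norm x" by auto
    then show "\<exists>k. 2 ^ k \<le> norm x \<and> norm x \<le> 2 * 2 ^ k"
      using dyadic_bracket[of "norm x"] by auto
  qed (use q in auto)
  also have "\<dots> < \<infinity>" by simp
  finally show ?thesis .
qed

section \<open>Finiteness and positivity of the normalising constant\<close>

lemma one_minus_cos_le: "1 - cos x \<le> x\<^sup>2" for x :: real
proof -
  have "cos x = 1 - 2 * (sin (x / 2))\<^sup>2"
    using cos_double_sin[of "x / 2"] by simp
  moreover have "(sin (x / 2))\<^sup>2 \<le> (x / 2)\<^sup>2"
    unfolding abs_le_square_iff[symmetric] by (rule abs_sin_x_le_abs_x)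
  moreover have "(x / 2)\<^sup>2 = x\<^sup>2 / 4" by (simp add: power_divide)
  moreover have "0 \<le> x\<^sup>2" by simp
  ultimately show ?thesis by linarith
qed

text \<open>
  Both convergence and positivity of the defining integral matter here: with \<open>enn2real \<infinity> = 0\<close> and
  \<open>inverse 0 = 0\<close> the constant would vanish otherwise.
\<close>
lemma CNs_pos:
  assumes s: "0 < s" "s < 1"
  shows "0 < CNs TYPE('a::euclidean_space) s"
proof -
  define b where "b = (SOME b::'a. b \<in> Basis)"
  have b: "b \<in> Basis" unfolding b_def by (rule some_in_eq[THEN iffD2]) simp
  define p where "p = real DIM('a) + 2 * s"
  define f where "f \<zeta> = ennreal ((1 - cos (\<zeta> \<bullet> b)) / norm \<zeta> powr p)" for \<zeta> :: 'a
  have [measurable]: "f \<in> borel_measurable borel" unfolding f_def by measurable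
  \<comment> \<open>Near the origin the numerator is at most \<open>(norm \<zeta>)\<^sup>2\<close>,
    and \<open>2 - p\<close> exceeds minus the dimension because \<open>s < 1\<close>. Far away it
    is at most 2, and \<open>- p\<close> lies below minus the dimension because
    \<open>s > 0\<close>.\<close>
  obtain C where C: "\<And>R. R > 0 \<Longrightarrow>
    (\<integral>\<^sup>+ x \<in> ball (0::'a) R. ennreal (norm x powr (2 - p)) \<partial>lborel) \<le> ennreal (C * R powr (2 - p + real DIM('a)))"
    using nn_integral_norm_powr_ball_le[of "2 - p", where 'a='a] s by (auto simp: p_def)
  have "(\<integral>\<^sup>+ \<zeta>. f \<zeta> \<partial>lborel) \<le> (\<integral>\<^sup>+ \<zeta>. ennreal (norm \<zeta> powr (2 - p)) * indicator (ball (0::'a) 1) \<zeta>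
      + 2 * (ennreal (norm \<zeta> powr (- p)) * indicator (- ball 0 1) \<zeta>) \<partial>lborel)"
  proof (rule nn_integral_mono)
    fix \<zeta> :: 'a
    show "f \<zeta> \<le> ennreal (norm \<zeta> powr (2 - p)) * indicator (ball 0 1) \<zeta>
      + 2 * (ennreal (norm \<zeta> powr (- p)) * indicator (- ball 0 1) \<zeta>)"
    proof (cases "norm \<zeta> < 1")
      case True
      have "\<bar>\<zeta> \<bullet> b\<bar> \<le> norm \<zeta>" using Basis_le_norm[OF b] .
      then have "(\<zeta> \<bullet> b)\<^sup>2 \<le> (norm \<zeta>)\<^sup>2"
        by (metis abs_le_square_iff abs_norm_cancel)
      then have "1 - cos (\<zeta> \<bullet> b) \<le> (norm \<zeta>)\<^sup>2"
        using one_minus_cos_le[of "\<zeta> \<bullet> b"] by linarith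
      then have "(1 - cos (\<zeta> \<bullet> b)) / norm \<zeta> powr p \<le> (norm \<zeta>)\<^sup>2 / norm \<zeta> powr p"
        by (rule divide_right_mono) simp
      also have "\<dots> = norm \<zeta> powr (2 - p)"
        by (cases "\<zeta> = 0") (simp_all add: powr_diff)
      finally show ?thesis using True by (simp add: f_def ennreal_leI)
    next
      case False
      have "(1 - cos (\<zeta> \<bullet> b)) / norm \<zeta> powr p \<le> 2 / norm \<zeta> powr p"
        using cos_ge_minus_one[of "\<zeta> \<bullet> b"] by (intro divide_right_mono) (linarith, simp)
      also have "\<dots> = 2 * norm \<zeta> powr (- p)"
        by (simp add: powr_minus divide_inverse)
      finally have "f \<zeta> \<le> ennreal (2 * norm \<zeta> powr (- p))"
        unfolding f_def by (rule ennreal_leI)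
      then show ?thesis using False by (simp add: ennreal_mult)
    qed
  qed
  also have "\<dots> = (\<integral>\<^sup>+ \<zeta> \<in> ball (0::'a) 1. ennreal (norm \<zeta> powr (2 - p)) \<partial>lborel)
      + 2 * (\<integral>\<^sup>+ \<zeta>. ennreal (norm \<zeta> powr (- p)) * indicator (- ball (0::'a) 1) \<zeta> \<partial>lborel)"
    by (subst nn_integral_add, simp, simp, subst nn_integral_cmult) simp_all
  also have "\<dots> < \<infinity>"
    using C[of 1] nn_integral_norm_powr_outside_ball_finite[of "- p", where 'a='a] s
    by (auto simp: p_def ennreal_mult_eq_top_iff less_top[symmetric] top_unique)
  finally have fin: "(\<integral>\<^sup>+ \<zeta>. f \<zeta> \<partial>lborel) < \<infinity>" .
  have "(\<integral>\<^sup>+ \<zeta>. f \<zeta> \<partial>lborel) \<noteq> 0"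
  proof
    assume "(\<integral>\<^sup>+ \<zeta>. f \<zeta> \<partial>lborel) = 0"
    then have ae: "AE \<zeta> in lborel. f \<zeta> = 0"
      by (subst (asm) nn_integral_0_iff_AE) simp_all
    \<comment> \<open>Around the basis vector the coordinate stays between 1/2 and 3/2, where the
      cosine is below 1; this ball has positive measure.\<close>
    have "f \<zeta> \<noteq> 0" if "\<zeta> \<in> ball b (1/2)" for \<zeta>
    proof -
      have "\<bar>(b - \<zeta>) \<bullet> b\<bar> < 1/2"
        using Basis_le_norm[OF b, of "b - \<zeta>"] that by (simp add: dist_norm)
      then have z: "1/2 < \<zeta> \<bullet> b" "\<zeta> \<bullet> b < 3/2"
        using b unfolding abs_less_iff by (simp_all add: inner_diff_left inner_Basis)
      then have "cos (\<zeta> \<bullet> b) < cos 0"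
        using pi_gt3 by (intro cos_monotone_0_pi) auto
      moreover have "norm \<zeta> > 0" using z by auto
      ultimately show ?thesis by (auto simp: f_def)
    qed
    then have "AE \<zeta> in lborel. \<zeta> \<notin> ball b (1/2)"
      using ae by (auto elim!: eventually_mono)
    then have "emeasure lborel (ball b (1/2)) = 0"
      by (subst (asm) AE_iff_measurable[where N = "ball b (1/2)"]) auto
    then show False by (simp add: emeasure_ball)
  qed
  then have "0 < enn2real (\<integral>\<^sup>+ \<zeta>. f \<zeta> \<partial>lborel)"
    using fin by (simp add: enn2real_positive_iff less_top zero_less_iff_neq_zero)
  then show ?thesis
    unfolding CNs_def f_def p_def b_def by simp
qed

subsection \<open>The integrand near the origin\<close>

text \<open>A crude Young inequality: both a and b are replaced by \<open>a + b\<close>, and the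
  exponents add up to 1.\<close>

lemma powr_interpolate_le:
  fixes a b \<beta> :: real
  assumes "0 \<le> a" "0 \<le> b" "0 \<le> \<beta>" "\<beta> \<le> 1"
  shows "a powr \<beta> * b powr (1 - \<beta>) \<le> a + b"
proof -
  have "a powr \<beta> * b powr (1 - \<beta>) \<le> (a + b) powr \<beta> * (a + b) powr (1 - \<beta>)"
    using assms by (intro mult_mono powr_mono2) auto
  also have "\<dots> = (a + b) powr (\<beta> + (1 - \<beta>))" by (rule powr_add[symmetric])
  also have "\<dots> = a + b" using assms by simp
  finally show ?thesis .
qed

text \<open>The power e is shared out as
  \<open>\<eta> * \<beta> + \<kappa> * (1 - \<beta>) = e\<close>. For \<open>\<beta> < 1\<close>,
  the condition on e says that \<kappa> exceeds \<open>- n\<close> at \<open>\<eta> = 0\<close>, and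
  so still does for some positive \<eta>.\<close>

lemma weighted_young:
  fixes n e \<beta> :: real
  assumes n: "0 < n" and \<beta>: "0 \<le> \<beta>" "\<beta> \<le> 1" and e: "e + (1 - \<beta>) * n > 0"
  obtains \<eta> \<kappa> where "\<eta> > 0" "\<kappa> > - n"
    "\<And>r w. r > 0 \<Longrightarrow> w \<ge> 0 \<Longrightarrow> r powr e * vpow w \<beta> \<le> r powr \<eta> * w + r powr \<kappa>"
proof (cases "\<beta> = 1")
  case True
  \<comment> \<open>All of e, positive here, goes to w; \<open>\<kappa> = 0\<close> is just an
    admissible exponent.\<close>
  then show ?thesis using e n by (intro that[of e 0]) (simp_all add: vpow_def)
next
  case False
  then have \<beta>1: "\<beta> < 1" using \<beta> by simp
  \<comment> \<open>Half of the available gap, which leaves the other half for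
    \<open>\<kappa> > - n\<close>.\<close>
  define \<eta> where "\<eta> = (e + (1 - \<beta>) * n) / 2"
  define \<kappa> where "\<kappa> = (e - \<eta> * \<beta>) / (1 - \<beta>)"
  have \<eta>: "\<eta> > 0" using e by (simp add: \<eta>_def)
  have "\<eta> * \<beta> < 2 * \<eta>"
    using \<eta> \<beta>1 mult_strict_left_mono[of \<beta> 1 \<eta>] by linarith
  then have "\<eta> * \<beta> < e + (1 - \<beta>) * n" by (simp add: \<eta>_def)
  then have "- n * (1 - \<beta>) < e - \<eta> * \<beta>" by (simp add: algebra_simps)
  then have \<kappa>: "\<kappa> > - n" using \<beta>1 by (simp add: \<kappa>_def pos_less_divide_eq)
  have "r powr e * vpow w \<beta> \<le> r powr \<eta> * w + r powr \<kappa>" if r: "r > 0" and w: "w \<ge> 0" for r w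
  \<comment> \<open>At \<open>w = 0\<close> the convention in \<open>vpow\<close> gives 1 while
    \<open>0 powr 0 = 0\<close>, so \<open>\<beta> = 0\<close> is treated apart; there
    \<open>\<kappa> = e\<close>.\<close>
  proof (cases "\<beta> = 0")
    case True
    then show ?thesis using w by (simp add: vpow_def \<kappa>_def)
  next
    case False
    have "\<eta> * \<beta> + \<kappa> * (1 - \<beta>) = e" using \<beta>1 by (simp add: \<kappa>_def)
    then have "r powr e = (r powr \<eta>) powr \<beta> * (r powr \<kappa>) powr (1 - \<beta>)"
      by (simp add: powr_powr flip: powr_add)
    then have "r powr e * vpow w \<beta> = (r powr \<eta> * w) powr \<beta> * (r powr \<kappa>) powr (1 - \<beta>)"
      using False w by (simp add: vpow_def powr_mult)
    also have "\<dots> \<le> r powr \<eta> * w + r powr \<kappa>"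
      using w \<beta> by (intro powr_interpolate_le) simp_all
    finally show ?thesis .
  qed
  with \<eta> \<kappa> show ?thesis by (rule that)
qed

text \<open>Split \<open>y powr q\<close> into \<open>y powr (2 * \<beta>)\<close>, absorbed into
  \<open>vpow (v * y\<^sup>2) \<beta>\<close>, and the excess
  \<open>y powr (q - 2 * \<beta>)\<close>, estimated by the decay bound.\<close>

lemma integrand_le:
  fixes r v y M \<gamma> e \<alpha> \<beta> q B :: real
  assumes r: "r > 0" and v: "v \<ge> 0" and y: "0 \<le> y" "y \<le> M * r powr (- \<gamma>)" and M: "M \<ge> 0"
    and \<beta>: "0 \<le> \<beta>" and q: "2 * \<beta> < q"
    and young: "r powr (\<alpha> - (q - 2 * \<beta>) * \<gamma>) * vpow (v * y\<^sup>2) \<beta> \<le> B"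
  shows "r powr \<alpha> * vpow v \<beta> * y powr q \<le> M powr (q - 2 * \<beta>) * B"
\<comment> \<open>The factorisation of \<open>vpow (v * y\<^sup>2) \<beta>\<close> fails for
  \<open>y = 0\<close> and \<open>\<beta> = 0\<close>, where \<open>0 powr 0 = 0\<close>.\<close>
proof (cases "y = 0")
  case True
  have "0 \<le> r powr (\<alpha> - (q - 2 * \<beta>) * \<gamma>) * vpow (v * y\<^sup>2) \<beta>" by (simp add: vpow_def)
  then have "B \<ge> 0" using young by linarith
  then show ?thesis using True by simp
next
  case False
  then have y0: "y > 0" using y by simp
  have vp: "vpow (v * y\<^sup>2) \<beta> = vpow v \<beta> * y powr (2 * \<beta>)"
    using y0 v by (auto simp: vpow_def powr_mult powr_powr simp flip: powr_numeral)
  have "y powr (q - 2 * \<beta>) \<le> (M * r powr (- \<gamma>)) powr (q - 2 * \<beta>)"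
    using y q by (intro powr_mono2) auto
  also have "\<dots> = M powr (q - 2 * \<beta>) * r powr (- ((q - 2 * \<beta>) * \<gamma>))"
    using M by (simp add: powr_mult powr_powr mult_ac)
  finally have 1: "y powr (q - 2 * \<beta>) \<le> M powr (q - 2 * \<beta>) * r powr (- ((q - 2 * \<beta>) * \<gamma>))" .
  have "r powr \<alpha> * vpow v \<beta> * y powr q = r powr \<alpha> * vpow (v * y\<^sup>2) \<beta> * y powr (q - 2 * \<beta>)"
    unfolding vp using y0 by (simp add: mult.assoc flip: powr_add)
  also have "\<dots> \<le> r powr \<alpha> * vpow (v * y\<^sup>2) \<beta> * (M powr (q - 2 * \<beta>) * r powr (- ((q - 2 * \<beta>) * \<gamma>)))"
    using 1 by (intro mult_left_mono) (simp_all add: vpow_def)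
  also have "\<dots> = M powr (q - 2 * \<beta>) * (r powr \<alpha> * r powr (- ((q - 2 * \<beta>) * \<gamma>)) * vpow (v * y\<^sup>2) \<beta>)"
    by (simp only: mult_ac)
  also have "r powr \<alpha> * r powr (- ((q - 2 * \<beta>) * \<gamma>)) = r powr (\<alpha> - (q - 2 * \<beta>) * \<gamma>)"
    by (simp flip: powr_add)
  also have "M powr (q - 2 * \<beta>) * (r powr (\<alpha> - (q - 2 * \<beta>) * \<gamma>) * vpow (v * y\<^sup>2) \<beta>) \<le> M powr (q - 2 * \<beta>) * B"
    using young by (rule mult_left_mono) simp
  finally show ?thesis .
qed

text \<open>Unit norm bounds \<open>gagliardo_sq\<close> by 1, so after division by
  \<open>CNs / 2\<close> the density has integral at most \<open>2 / CNs\<close>. The radial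
  estimate thus has the same constant for all u on the unit sphere.\<close>

lemma HV_unit_sphere_bounds:
  fixes u :: "'a::euclidean_space \<Rightarrow> real"
  assumes s: "1/2 < s" "s < 1" and N: "DIM('a) \<ge> 2"
    and u: "u \<in> HV_rad s V" "HV_norm_sq s V u = 1"
  shows "u \<in> borel_measurable borel" "V_part V u \<le> 1"
    "AE x in lborel. \<bar>u x\<bar> \<le> strauss_const DIM('a) s * sqrt (2 / CNs TYPE('a) s) * norm x powr (s - real DIM('a) / 2)"
proof -
  define c where "c = CNs TYPE('a) s"
  have c: "c > 0" unfolding c_def using s by (intro CNs_pos) auto
  have 2: "2 * s < real DIM('a)" using s N by linarith
  show [measurable]: "u \<in> borel_measurable borel"
    using u by (simp add: HV_rad_def HV_def Hdot_def)
  have rad: "radial u" using u by (simp add: HV_rad_def)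
  have Lp: "(\<integral>\<^sup>+ x. ennreal (\<bar>u x\<bar> powr crit_exp DIM('a) s) \<partial>lborel) < \<infinity>"
    and gfin: "gagliardo_sq s u < \<infinity>" and vfin: "V_part V u < \<infinity>"
    using u by (auto simp: HV_rad_def HV_def Hdot_def)
  obtain g where g: "gagliardo_sq s u = ennreal g" "g \<ge> 0"
    using gfin by (cases "gagliardo_sq s u") auto
  obtain v where v: "V_part V u = ennreal v" "v \<ge> 0"
    using vfin by (cases "V_part V u") auto
  have gv: "g + v = 1" using u(2) g v by (simp add: HV_norm_sq_def)
  then show "V_part V u \<le> 1" using v g by simp
  have "ennreal (c / 2) * (\<integral>\<^sup>+ x. gagliardo_density s u x \<partial>lborel) = ennreal g"
    using g(1) unfolding gagliardo_sq_def gagliardo_density_def c_def .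
  then have "ennreal (2 / c) * (ennreal (c / 2) * (\<integral>\<^sup>+ x. gagliardo_density s u x \<partial>lborel))
      = ennreal (2 / c) * ennreal g" by simp
  then have "(\<integral>\<^sup>+ x. gagliardo_density s u x \<partial>lborel) = ennreal (2 / c) * ennreal g"
    using c by (simp add: mult.assoc[symmetric] flip: ennreal_mult)
  also have "\<dots> = ennreal (2 / c * g)" using c g by (intro ennreal_mult[symmetric]) auto
  also have "\<dots> \<le> ennreal (2 / c)"
    using c g v gv by (intro ennreal_leI) (simp add: divide_right_mono)
  finally have G: "(\<integral>\<^sup>+ x. gagliardo_density s u x \<partial>lborel) \<le> ennreal (2 / c)" .
  have "crit_exp DIM('a) s \<ge> 1"
    using s 2 by (simp add: crit_exp_def)
  moreover have "integrable lborel (\<lambda>x. \<bar>u x\<bar> powr crit_exp DIM('a) s)"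
    using Lp by (intro integrableI_nonneg) auto
  ultimately show "AE x in lborel. \<bar>u x\<bar> \<le> strauss_const DIM('a) s * sqrt (2 / CNs TYPE('a) s) * norm x powr (s - real DIM('a) / 2)"
    using rad s 2 G c by (intro radial_bound_AE[where p = "crit_exp DIM('a) s"]) (auto simp: c_def)
qed

section \<open>Smallness near the origin, uniformly on the unit sphere\<close>

theorem theorem4p3:
  fixes V K :: "real \<Rightarrow> real" and s \<alpha>0 \<beta>0 q1 :: real
  assumes "DIM('a::euclidean_space) \<ge> 2"
    and "1/2 < s" "s < 1"
    and "continuous_on {0<..} V" "\<And>r. r > 0 \<Longrightarrow> V r \<ge> 0"
    and "continuous_on {0<..} K" "\<And>r. r > 0 \<Longrightarrow> K r > 0"
    and "\<exists>R1>0. \<exists>C. \<forall>r\<in>{0<..<R1}. K r \<le> C * (r powr \<alpha>0 * vpow (V r) \<beta>0)"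
    and "0 \<le> \<beta>0" "\<beta>0 \<le> 1" "\<alpha>0 > alpha_star DIM('a) s \<beta>0"
    and "max 1 (2 * \<beta>0) < q1" "q1 < q_star DIM('a) \<alpha>0 \<beta>0 s"
  shows "((\<lambda>R. S0 TYPE('a) s V K q1 R) \<longlongrightarrow> 0) (at_right 0)"
proof -
  define n where "n = real DIM('a)"
  have n: "n \<ge> 2" using assms(1) by (simp add: n_def)
  have sn: "2 * s < n" using assms(3) n by linarith
  define \<gamma> where "\<gamma> = n / 2 - s"
  \<comment> \<open>The power of r that remains once the excess \<open>q1 - 2 * \<beta>0\<close> of
    \<bar>u\<bar> is replaced by its decay with exponent \<open>- \<gamma>\<close>.\<close>
  define e where "e = \<alpha>0 - (q1 - 2 * \<beta>0) * \<gamma>"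
  define M where "M = strauss_const DIM('a) s * sqrt (2 / CNs TYPE('a) s)"
  have M: "M \<ge> 0"
    unfolding M_def using assms(2,3) sn CNs_pos[of s, where 'a='a]
    by (intro mult_nonneg_nonneg strauss_const_nonneg) (auto simp: n_def)
  have q: "2 * \<beta>0 < q1" using assms(12) by simp
  have "q1 * (n - 2 * s) < 2 * (\<alpha>0 - 2 * s * \<beta>0 + n)"
    using assms(13) sn by (simp add: q_star_def n_def pos_less_divide_eq)
  \<comment> \<open>Twice this quantity is the difference of the two sides of the preceding
    inequality.\<close>
  then have "e + (1 - \<beta>0) * n > 0"
    by (simp add: e_def \<gamma>_def algebra_simps)
  then obtain \<eta> \<kappa> where \<eta>: "\<eta> > 0" and \<kappa>: "\<kappa> > - n"
    and young: "\<And>r w. r > 0 \<Longrightarrow> w \<ge> 0 \<Longrightarrow> r powr e * vpow w \<beta>0 \<le> r powr \<eta> * w + r powr \<kappa>"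
    using weighted_young[of n \<beta>0 e] n assms(9,10) by auto
  obtain C1 where C1: "C1 \<ge> 0" "\<And>R. R > 0 \<Longrightarrow>
    (\<integral>\<^sup>+ x \<in> ball (0::'a) R. ennreal (norm x powr \<kappa>) \<partial>lborel) \<le> ennreal (C1 * R powr (\<kappa> + n))"
    using nn_integral_norm_powr_ball_le[of \<kappa>, where 'a='a] \<kappa> unfolding n_def by metis
  obtain R1 C0 where R1: "R1 > 0"
    and K0: "\<And>r. 0 < r \<Longrightarrow> r < R1 \<Longrightarrow> K r \<le> C0 * (r powr \<alpha>0 * vpow (V r) \<beta>0)"
    using assms(8) by (metis greaterThanLessThan_iff)
  \<comment> \<open>The absolute value spares a discussion of the sign of \<open>C0\<close>.\<close>
  define C where "C = \<bar>C0\<bar> * M powr (q1 - 2 * \<beta>0)"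
  have C: "C \<ge> 0" by (simp add: C_def)
  \<comment> \<open>V is continuous only on the positive reals. Its extension by 0 is Borel on the
    whole line and changes \<open>V (norm x)\<close> at most at the origin.\<close>
  define W where "W r = indicator {0<..} r * V r" for r
  have W_meas [measurable]: "W \<in> borel_measurable borel"
    using borel_measurable_continuous_on_indicator[OF _ assms(4)] unfolding W_def by simp
  have W: "W r \<ge> 0" for r using assms(5) by (simp add: W_def indicator_def)

  have bound: "S0 TYPE('a) s V K q1 R \<le> ennreal (C * (R powr \<eta> + C1 * R powr (\<kappa> + n)))"
    if R: "0 < R" "R < R1" for R
    unfolding S0_def
  proof (rule SUP_least)
    fix u :: "'a \<Rightarrow> real"
    assume "u \<in> {u. u \<in> HV_rad s V \<and> HV_norm_sq s V u = 1}"
    then have "u \<in> HV_rad s V" "HV_norm_sq s V u = 1" by auto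
    note u = HV_unit_sphere_bounds[OF assms(2,3,1) this]
    note [measurable] = u(1)
    have AE0: "AE x in lborel. x \<noteq> (0::'a)" by (rule AE_lborel_singleton)
    have VW: "(\<integral>\<^sup>+ x. ennreal (W (norm x) * (u x)\<^sup>2) \<partial>lborel) \<le> 1"
    proof -
      have "(\<integral>\<^sup>+ x. ennreal (W (norm x) * (u x)\<^sup>2) \<partial>lborel) = V_part V u"
        unfolding V_part_def by (rule nn_integral_cong_AE) (use AE0 in \<open>eventually_elim, simp add: W_def\<close>)
      then show ?thesis using u(2) by simp
    qed
    have "(\<integral>\<^sup>+ x \<in> ball 0 R. ennreal (K (norm x) * \<bar>u x\<bar> powr q1) \<partial>lborel)
      \<le> (\<integral>\<^sup>+ x. ennreal C * (ennreal (R powr \<eta>) * ennreal (W (norm x) * (u x)\<^sup>2)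
          + ennreal (norm x powr \<kappa>) * indicator (ball 0 R) x) \<partial>lborel)"
    proof (rule nn_integral_mono_AE)
      show "AE x in lborel. ennreal (K (norm x) * \<bar>u x\<bar> powr q1) * indicator (ball 0 R) x
        \<le> ennreal C * (ennreal (R powr \<eta>) * ennreal (W (norm x) * (u x)\<^sup>2)
          + ennreal (norm x powr \<kappa>) * indicator (ball 0 R) x)"
        using AE0 u(3)
      proof eventually_elim
        case (elim x)
        show ?case
        proof (cases "norm x < R")
          case True
          define r where "r = norm x"
          have r: "0 < r" "r < R" "r < R1" using elim True R by (auto simp: r_def)
          have v: "V r \<ge> 0" "W r = V r" using r assms(5) by (simp_all add: W_def)
          have y: "\<bar>u x\<bar> \<le> M * r powr (- \<gamma>)"
            using elim(2) by (simp add: M_def r_def \<gamma>_def n_def)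
          have "r powr e * vpow (V r * \<bar>u x\<bar>\<^sup>2) \<beta>0 \<le> r powr \<eta> * (V r * \<bar>u x\<bar>\<^sup>2) + r powr \<kappa>"
            using r v by (intro young) simp_all
          \<comment> \<open>Since \<open>r < R\<close> and \<open>\<eta> > 0\<close>, the small
            factor \<open>R powr \<eta>\<close> can leave the integral.\<close>
          also have "\<dots> \<le> R powr \<eta> * (V r * (u x)\<^sup>2) + r powr \<kappa>"
            using r v \<eta> by (simp add: mult_right_mono powr_mono2)
          finally have main: "r powr \<alpha>0 * vpow (V r) \<beta>0 * \<bar>u x\<bar> powr q1
              \<le> M powr (q1 - 2 * \<beta>0) * (R powr \<eta> * (V r * (u x)\<^sup>2) + r powr \<kappa>)"
            using r v y M assms(9) q unfolding e_def by (intro integrand_le) simp_all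
          have "K r \<le> \<bar>C0\<bar> * (r powr \<alpha>0 * vpow (V r) \<beta>0)"
            using K0[OF r(1,3)] by (rule order_trans) (intro mult_right_mono, simp_all add: vpow_def)
          then have "K r * \<bar>u x\<bar> powr q1 \<le> \<bar>C0\<bar> * (r powr \<alpha>0 * vpow (V r) \<beta>0) * \<bar>u x\<bar> powr q1"
            by (rule mult_right_mono) simp
          also have "\<dots> \<le> \<bar>C0\<bar> * (M powr (q1 - 2 * \<beta>0) * (R powr \<eta> * (V r * (u x)\<^sup>2) + r powr \<kappa>))"
            unfolding mult.assoc by (intro mult_left_mono main[unfolded mult.assoc]) simp
          also have "\<dots> = C * (R powr \<eta> * (W r * (u x)\<^sup>2) + r powr \<kappa>)"
            by (simp add: C_def v(2))
          finally have "ennreal (K r * \<bar>u x\<bar> powr q1)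
              \<le> ennreal (C * (R powr \<eta> * (W r * (u x)\<^sup>2) + r powr \<kappa>))"
            by (rule ennreal_leI)
          also have "\<dots> = ennreal C * (ennreal (R powr \<eta>) * ennreal (W r * (u x)\<^sup>2) + ennreal (r powr \<kappa>))"
            using C W[of r] by (simp add: ennreal_mult ennreal_plus)
          finally show ?thesis using True by (simp add: r_def)
        qed simp
      qed
    qed
    also have "\<dots> = ennreal C * (ennreal (R powr \<eta>) * (\<integral>\<^sup>+ x. ennreal (W (norm x) * (u x)\<^sup>2) \<partial>lborel)
        + (\<integral>\<^sup>+ x \<in> ball (0::'a) R. ennreal (norm x powr \<kappa>) \<partial>lborel))"
      by (subst nn_integral_cmult, measurable, subst nn_integral_add, measurable, subst nn_integral_cmult, measurable)
    \<comment> \<open>The V-part of u is at most 1 and the other integral does not involve u, so the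
      bound is uniform in u.\<close>
    also have "\<dots> \<le> ennreal C * (ennreal (R powr \<eta>) * 1 + ennreal (C1 * R powr (\<kappa> + n)))"
      using R by (intro mult_left_mono add_mono VW C1) simp_all
    also have "\<dots> = ennreal (C * (R powr \<eta> + C1 * R powr (\<kappa> + n)))"
      using C C1(1) by (simp add: ennreal_mult)
    finally show "(\<integral>\<^sup>+ x \<in> ball 0 R. ennreal (K (norm x) * \<bar>u x\<bar> powr q1) \<partial>lborel)
      \<le> ennreal (C * (R powr \<eta> + C1 * R powr (\<kappa> + n)))" .
  qed

  have pos: "eventually (\<lambda>R::real. 0 \<le> R) (at_right 0)"
    by (rule eventually_at_right_less[THEN eventually_mono]) simp
  have id0: "((\<lambda>R::real. R) \<longlongrightarrow> 0) (at_right 0)" by (rule tendsto_ident_at)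
  \<comment> \<open>Both exponents are positive, the second because
    \<open>\<kappa> > - n\<close>.\<close>
  have "((\<lambda>R. C * (R powr \<eta> + C1 * R powr (\<kappa> + n))) \<longlongrightarrow> C * (0 + C1 * 0)) (at_right 0)"
    using \<eta> \<kappa> by (intro tendsto_intros tendsto_zero_powrI[OF id0 tendsto_const pos]) simp_all
  then have "((\<lambda>R. ennreal (C * (R powr \<eta> + C1 * R powr (\<kappa> + n)))) \<longlongrightarrow> ennreal 0) (at_right 0)"
    by (intro tendsto_ennrealI) simp
  then have lim: "((\<lambda>R. ennreal (C * (R powr \<eta> + C1 * R powr (\<kappa> + n)))) \<longlongrightarrow> 0) (at_right 0)"
    by simp
  have "eventually (\<lambda>R. R \<in> {0<..<R1}) (at_right 0)"
    using R1 by (rule eventually_at_right_real)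
  then have "eventually (\<lambda>R. S0 TYPE('a) s V K q1 R \<le> ennreal (C * (R powr \<eta> + C1 * R powr (\<kappa> + n)))) (at_right 0)"
    by (rule eventually_mono) (use bound in auto)
  then show ?thesis
    by (intro tendsto_sandwich[OF _ _ tendsto_const lim]) simp_all
qed

end
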